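(* Let $k,\ell$ be kernels on a non-empty set $X$. If $\ell$ is non-vanishing (i.e. $\ell(z,w)\ne0$ for all $z,w\in X$), then the following are equivalent: $(k,\ell)$ has a Shimorin certificate; $(k,\ell)$ has a strong Shimorin certificate; there exist a kernel $p$ on $X$ and a point $z_0\in X$ with $$\ell^{z_0}\succeq p\,\ell\quad\text{and}\quad k^{z_0}\preceq p\,k.$$
   Context: A kernel on a non-empty set $X$ is a function $k:X\times X\to\mathbb{C}$ such that $[k(z_i,z_j)]_{i,j=1}^n$ is positive semi-definite for all finite choices of points; $k_1\succeq k_2$ (or $k_2\preceq k_1$) means $k_1-k_2$ is a kernel; $\mathcal{H}_k$ is the reproducing kernel Hilbert space. Standing assumption: $k(x,x)\ne0\ne\ell(x,x)$ for all $x\in X$. For $z\in X$, $k^z(w,v)=k(w,v)-\frac{k(w,z)k(z,v)}{k(z,z)}$, and similarly $\ell^z$. A Shimorin certificate for $(k,\ell)$ is a family of kernels $\{p[z]\}_{z\in X}$ on $X$ such that $\ell^z\succeq p[z]\ell$ and $k^z\preceq p[z]k$ for every $z\in X$ (pointwise products; the $p[z]$ may vanish on the diagonal). A strong Shimorin certificate for $(k,\ell)$ is a complete Pick kernel $s$ on $X$ for which there are kernels $h,g$ on $X$ with $k=(1-h)s$ and $\ell=sg$. A kernel $s$ on $X$ is a complete Pick kernel if for all $n,N\ge1$, all $z_1,\dots,z_n\in X$ and all complex $N\times N$ matrices $W_1,\dots,W_n$ with $[s(z_i,z_j)(I_{N\times N}-W_iW_j^* )]_{i,j=1}^n$ positive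 semi-definite, there is a function $\Phi:X\to\mathbb{M}_N$ (complex $N\times N$ matrices) which multiplies $\mathcal{H}_s\otimes\mathbb{C}^N$ into itself with multiplication operator of norm at most one and satisfies $\Phi(z_i)=W_i$ for all $i$. *)

theory Defs
  imports Complex_Main "HOL-Library.Complex_Order" "Jordan_Normal_Form.Schur_Decomposition"
begin

text \<open>The non-empty set on which kernels live is the type \<open>'a\<close>.\<close>

text \<open>Positive semi-definiteness of a complex matrix with rows and columns indexed by a finite
  set \<open>I\<close>. The order on \<^typ>\<open>complex\<close> is that of \<open>Complex_Order\<close>: \<open>0 \<le> z\<close> says that \<open>z\<close> is real
  and non-negative.\<close>

definition psd_on :: "'i set \<Rightarrow> ('i \<Rightarrow> 'i \<Rightarrow> complex) \<Rightarrow> bool" where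
  "psd_on I A \<longleftrightarrow>
     (\<forall>c :: 'i \<Rightarrow> complex. 0 \<le> (\<Sum>i\<in>I. \<Sum>j\<in>I. cnj (c i) * A i j * c j))"

definition is_kernel :: "('a \<Rightarrow> 'a \<Rightarrow> complex) \<Rightarrow> bool" where
  "is_kernel k \<longleftrightarrow> (\<forall>(n :: nat) (z :: nat \<Rightarrow> 'a). psd_on {..<n} (\<lambda>i j. k (z i) (z j)))"

definition kernel_le :: "('a \<Rightarrow> 'a \<Rightarrow> complex) \<Rightarrow> ('a \<Rightarrow> 'a \<Rightarrow> complex) \<Rightarrow> bool" where
  "kernel_le k1 k2 \<longleftrightarrow> is_kernel (\<lambda>w v. k2 w v - k1 w v)"

text \<open>The function written $k^z$.\<close>

definition kernel_at :: "('a \<Rightarrow> 'a \<Rightarrow> complex) \<Rightarrow> 'a \<Rightarrow> 'a \<Rightarrow> 'a \<Rightarrow> complex" where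
  "kernel_at k z = (\<lambda>w v. k w v - k w z * k z v / k z z)"

text \<open>\<open>rkhs k H ip\<close>: the set \<open>H\<close> of functions, with inner product \<open>ip\<close> (linear in the first
  argument, relevant only on \<open>H\<close>), is the Hilbert function space with reproducing kernel \<open>k\<close>.
  By the Moore--Aronszajn theorem every kernel \<open>k\<close> has such a space, and \<open>H\<close> together with the
  restriction of \<open>ip\<close> to \<open>H\<close> is uniquely determined by \<open>k\<close>.\<close>

locale rkhs =
  fixes k :: "'a \<Rightarrow> 'a \<Rightarrow> complex"
    and H :: "('a \<Rightarrow> complex) set"
    and ip :: "('a \<Rightarrow> complex) \<Rightarrow> ('a \<Rightarrow> complex) \<Rightarrow> complex"
  assumes zero_mem: "(\<lambda>x. 0) \<in> H"
    and add_mem: "\<And>f g. f \<in> H \<Longrightarrow> g \<in> H \<Longrightarrow> (\<lambda>x. f x + g x) \<in> H"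
    and scale_mem: "\<And>c f. f \<in> H \<Longrightarrow> (\<lambda>x. c * f x) \<in> H"
    and ip_add: "\<And>f g h. f \<in> H \<Longrightarrow> g \<in> H \<Longrightarrow> h \<in> H \<Longrightarrow>
                   ip (\<lambda>x. f x + g x) h = ip f h + ip g h"
    and ip_scale: "\<And>c f g. f \<in> H \<Longrightarrow> g \<in> H \<Longrightarrow> ip (\<lambda>x. c * f x) g = c * ip f g"
    and ip_sym: "\<And>f g. f \<in> H \<Longrightarrow> g \<in> H \<Longrightarrow> ip g f = cnj (ip f g)"
    and ip_nonneg: "\<And>f. f \<in> H \<Longrightarrow> 0 \<le> ip f f"
    and ip_definite: "\<And>f. f \<in> H \<Longrightarrow> ip f f = 0 \<Longrightarrow> f = (\<lambda>x. 0)"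
    and complete:
      "\<And>F :: nat \<Rightarrow> 'a \<Rightarrow> complex.
         (\<And>n. F n \<in> H) \<Longrightarrow>
         (\<And>e. e > 0 \<Longrightarrow> \<exists>M. \<forall>m\<ge>M. \<forall>n\<ge>M.
            sqrt (Re (ip (\<lambda>x. F m x - F n x) (\<lambda>x. F m x - F n x))) < e) \<Longrightarrow>
         \<exists>f\<in>H. (\<lambda>n. sqrt (Re (ip (\<lambda>x. F n x - f x) (\<lambda>x. F n x - f x)))) \<longlonglongrightarrow> 0"
    and kernel_mem: "\<And>y. (\<lambda>x. k x y) \<in> H"
    and reproducing: "\<And>f y. f \<in> H \<Longrightarrow> ip f (\<lambda>x. k x y) = f y"

text \<open>The tensor product of \<open>H\<close> with $\mathbb{C}^N$: functions into $\mathbb{C}^N$ all of whose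
  components lie in \<open>H\<close>, normed by the Hilbert sum of the components.\<close>

definition tensor_space :: "('a \<Rightarrow> complex) set \<Rightarrow> nat \<Rightarrow> ('a \<Rightarrow> complex vec) set" where
  "tensor_space H N = {f. (\<forall>x. f x \<in> carrier_vec N) \<and> (\<forall>a<N. (\<lambda>x. f x $ a) \<in> H)}"

definition tensor_norm ::
  "(('a \<Rightarrow> complex) \<Rightarrow> ('a \<Rightarrow> complex) \<Rightarrow> complex) \<Rightarrow> nat \<Rightarrow> ('a \<Rightarrow> complex vec) \<Rightarrow> real" where
  "tensor_norm ip N f = sqrt (\<Sum>a<N. Re (ip (\<lambda>x. f x $ a) (\<lambda>x. f x $ a)))"

definition contractive_multiplier ::
  "('a \<Rightarrow> complex) set \<Rightarrow> (('a \<Rightarrow> complex) \<Rightarrow> ('a \<Rightarrow> complex) \<Rightarrow> complex) \<Rightarrow> nat \<Rightarrow>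
   ('a \<Rightarrow> complex mat) \<Rightarrow> bool" where
  "contractive_multiplier H ip N \<Phi> \<longleftrightarrow>
     (\<forall>x. \<Phi> x \<in> carrier_mat N N) \<and>
     (\<forall>f \<in> tensor_space H N.
        (\<lambda>x. \<Phi> x *\<^sub>v f x) \<in> tensor_space H N \<and>
        tensor_norm ip N (\<lambda>x. \<Phi> x *\<^sub>v f x) \<le> tensor_norm ip N f)"

text \<open>The block matrix $[s(z_i,z_j)(I - W_i W_j^*)]$ is indexed by pairs (block, position inside
  the block).\<close>

definition pick_matrix ::
  "('a \<Rightarrow> 'a \<Rightarrow> complex) \<Rightarrow> nat \<Rightarrow> (nat \<Rightarrow> 'a) \<Rightarrow> (nat \<Rightarrow> complex mat) \<Rightarrow>
   nat \<times> nat \<Rightarrow> nat \<times> nat \<Rightarrow> complex" where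
  "pick_matrix s N z W = (\<lambda>(i, a) (j, b).
     s (z i) (z j) * (1\<^sub>m N - W i * mat_adjoint (W j)) $$ (a, b))"

definition complete_pick_kernel :: "('a \<Rightarrow> 'a \<Rightarrow> complex) \<Rightarrow> bool" where
  "complete_pick_kernel s \<longleftrightarrow>
     is_kernel s \<and>
     (\<exists>H ip. rkhs s H ip \<and>
        (\<forall>(n :: nat) (N :: nat) (z :: nat \<Rightarrow> 'a) (W :: nat \<Rightarrow> complex mat).
           n \<ge> 1 \<longrightarrow> N \<ge> 1 \<longrightarrow> (\<forall>i<n. W i \<in> carrier_mat N N) \<longrightarrow>
           psd_on ({..<n} \<times> {..<N}) (pick_matrix s N z W) \<longrightarrow>
           (\<exists>\<Phi>. contractive_multiplier H ip N \<Phi> \<and> (\<forall>i<n. \<Phi> (z i) = W i))))"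

definition shimorin_certificate ::
  "('a \<Rightarrow> 'a \<Rightarrow> complex) \<Rightarrow> ('a \<Rightarrow> 'a \<Rightarrow> complex) \<Rightarrow> ('a \<Rightarrow> 'a \<Rightarrow> 'a \<Rightarrow> complex) \<Rightarrow> bool" where
  "shimorin_certificate k l p \<longleftrightarrow>
     (\<forall>z. is_kernel (p z) \<and>
          kernel_le (\<lambda>w v. p z w v * l w v) (kernel_at l z) \<and>
          kernel_le (kernel_at k z) (\<lambda>w v. p z w v * k w v))"

definition strong_shimorin_certificate ::
  "('a \<Rightarrow> 'a \<Rightarrow> complex) \<Rightarrow> ('a \<Rightarrow> 'a \<Rightarrow> complex) \<Rightarrow> ('a \<Rightarrow> 'a \<Rightarrow> complex) \<Rightarrow> bool" where
  "strong_shimorin_certificate k l s \<longleftrightarrow>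
     complete_pick_kernel s \<and>
     (\<exists>h g. is_kernel h \<and> is_kernel g \<and>
        (\<forall>w v. k w v = (1 - h w v) * s w v) \<and>
        (\<forall>w v. l w v = s w v * g w v))"

end

theory Submission
  imports Defs "HOL-Analysis.L2_Norm"
begin

text \<open>
  Write \<open>K \<ge> 0\<close> for positive definiteness, \<open>K\<^sub>z\<close> for the column \<open>x \<mapsto> K x z\<close>, and \<open>f f*\<close> for the
  rank-one kernel \<open>f x * cnj (f y)\<close>. The link between the inequalities at the points and complete
  Pick kernels is the theorem of McCullough, Quiggin, Agler and McCarthy: a non-vanishing kernel
  \<open>s\<close> is a complete Pick kernel if and only if \<open>s = \<kappa> \<kappa>* / (1 - p)\<close> with a function \<open>\<kappa>\<close>
  without zeros and a kernel \<open>p\<close> that is less than \<open>1\<close> on the diagonal, and then \<open>s\<^sup>z / s \<ge> 0\<close> for every \<open>z\<close>. Both directions are proved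
  below (\<open>complete_pick_of_normalized_form\<close>, \<open>pd_quotient_by_complete_pick\<close>). Granted this, the
  equivalence is a computation.

  \<^bold>\<open>From one point to a strong certificate.\<close> The hypotheses at \<open>z\<close> say
  \<open>(1 - p) l = l\<^sub>z l\<^sub>z* / l(z,z) + R\<close> and \<open>(1 - p) k = k\<^sub>z k\<^sub>z* / k(z,z) - R'\<close> with \<open>R, R' \<ge> 0\<close>.
  On the diagonal, the first identity gives \<open>p < 1\<close> because \<open>l\<close> has no zeros, and the second one then
  shows that \<open>\<kappa> = k\<^sub>z / sqrt k(z,z)\<close> has no zeros. So \<open>s = \<kappa> \<kappa>* / (1 - p)\<close> is a complete Pick kernel,
  and dividing the two identities by \<open>\<kappa> \<kappa>*\<close> displays \<open>l / s\<close> and \<open>1 - k / s\<close> as kernels.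

  \<^bold>\<open>From a strong certificate to a certificate.\<close> Take \<open>p[z] = s\<^sup>z / s\<close>. With \<open>k = (1 - h) s\<close> and
  \<open>l = s g\<close>, the differences \<open>l\<^sup>z - p[z] l\<close> and \<open>p[z] k - k\<^sup>z\<close> are \<open>s\<^sub>z s\<^sub>z* / s(z,z)\<close> times
  \<open>g\<^sup>z\<close> and times \<open>(1 - h\<^sub>z) (1 - h\<^sub>z)* / (1 - h(z,z)) - (1 - h)\<close>, and the last factor is positive
  definite whenever \<open>h(z,z) < 1\<close> (\<open>pd_moebius_defect\<close>).

  \<^bold>\<open>Normalized kernels are complete Pick kernels.\<close> Finitely many interpolation conditions only
  see a finite-rank part \<open>q\<close> of \<open>p\<close>. A Cholesky factorization turns the Pick condition into the
  equality of two finite Gram matrices, that is, into a contraction between finite-dimensional spaces.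
  Solving the linear relation described by this contraction at an arbitrary point \<open>x\<close> defines the
  interpolant \<open>\<Phi>\<close> on the whole of \<open>X\<close> at once (\<open>pick_interpolation\<close>); no limit is needed,
  since \<open>(1 - q) / (1 - p) = 1 + (p - q) / (1 - p)\<close> is a kernel. What is obtained is
  \<open>s (1 - \<Phi> \<Phi>*) \<ge> 0\<close>. It yields a contractive multiplier
  because a function lies in the ball of radius \<open>C\<close> of the Hilbert space of \<open>s\<close> precisely when
  \<open>C\<^sup>2 s - f f* \<ge> 0\<close>; the Hilbert space is constructed here from this description.

  \<^bold>\<open>Complete Pick kernels are normalized.\<close> The proof that \<open>s\<^sup>z / s \<ge> 0\<close> on a finite set is an
  induction on the number of points. If \<open>s\<^sup>w / s = b b*\<close> for one of the points \<open>w\<close>, then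
  \<open>s (1 - b b*) = s\<^sub>w s\<^sub>w* / s(w,w) \<ge> 0\<close>, so the rows \<open>b\<close> are solvable Pick data. The interpolating multiplier
  maps functions vanishing at \<open>z\<close> to such functions, hence \<open>s\<^sup>z (1 - b b*) \<ge> 0\<close>, and after division
  by the rank-one kernel this is \<open>s\<^sup>z / s \<ge> 0\<close>.
\<close>

section \<open>Positive definite functions\<close>

text \<open>Kernels are needed on infinite sets, but also on sets such as \<open>X \<times> {..<N}\<close> and on finite index sets
of matrices; quantifying over finite subsets instead of sequences with repetitions treats all of
these alike.\<close>

definition pd :: "'a set \<Rightarrow> ('a \<Rightarrow> 'a \<Rightarrow> complex) \<Rightarrow> bool" where
  "pd S K \<longleftrightarrow> (\<forall>F. finite F \<longrightarrow> F \<subseteq> S \<longrightarrow> psd_on F K)"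

lemma pdI:
  assumes "\<And>F c. finite F \<Longrightarrow> F \<subseteq> S \<Longrightarrow> 0 \<le> (\<Sum>x\<in>F. \<Sum>y\<in>F. cnj (c x) * K x y * c y)"
  shows "pd S K"
  using assms by (auto simp: pd_def psd_on_def)

lemma pdD:
  assumes "pd S K" "finite F" "F \<subseteq> S"
  shows "0 \<le> (\<Sum>x\<in>F. \<Sum>y\<in>F. cnj (c x) * K x y * c y)"
  using assms by (auto simp: pd_def psd_on_def)

lemma complex_norm_square_nonneg: "0 \<le> z * cnj z" "0 \<le> cnj z * z"
  by (auto simp: less_eq_complex_def)

lemma form_extend:
  fixes K :: "'a \<Rightarrow> 'a \<Rightarrow> complex"
  assumes "finite G" "F \<subseteq> G"
  shows "(\<Sum>x\<in>G. \<Sum>y\<in>G. cnj (if x \<in> F then c x else 0) * K x y * (if y \<in> F then c y else 0))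
    = (\<Sum>x\<in>F. \<Sum>y\<in>F. cnj (c x) * K x y * c y)"
proof -
  have "(\<Sum>x\<in>G. \<Sum>y\<in>G. cnj (if x \<in> F then c x else 0) * K x y * (if y \<in> F then c y else 0))
     = (\<Sum>x\<in>F. \<Sum>y\<in>G. cnj (if x \<in> F then c x else 0) * K x y * (if y \<in> F then c y else 0))"
    by (rule sum.mono_neutral_right) (use assms in auto)
  also have "\<dots> = (\<Sum>x\<in>F. \<Sum>y\<in>F. cnj (if x \<in> F then c x else 0) * K x y * (if y \<in> F then c y else 0))"
    by (rule sum.cong[OF refl], rule sum.mono_neutral_right) (use assms in auto)
  finally show ?thesis by simp
qed

text \<open>Repeated points cost nothing: the coefficients of all indices with the same image are added up.\<close>

lemma psd_on_reindex:
  assumes "finite I" "finite J" "\<phi> ` I \<subseteq> J" "psd_on J A"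
  shows "psd_on I (\<lambda>i j. A (\<phi> i) (\<phi> j))"
  unfolding psd_on_def
proof
  fix c :: "'a \<Rightarrow> complex"
  define d where "d x = (\<Sum>i\<in>{i\<in>I. \<phi> i = x}. c i)" for x
  have "(\<Sum>i\<in>I. \<Sum>j\<in>I. cnj (c i) * A (\<phi> i) (\<phi> j) * c j)
     = (\<Sum>i\<in>I. cnj (c i) * (\<Sum>j\<in>I. A (\<phi> i) (\<phi> j) * c j))"
    by (simp add: sum_distrib_left mult.assoc)
  also have "\<dots> = (\<Sum>i\<in>I. cnj (c i) * (\<Sum>y\<in>J. A (\<phi> i) y * d y))"
  proof -
    have "(\<Sum>j\<in>I. B (\<phi> j) * c j) = (\<Sum>y\<in>J. B y * d y)" for B
      unfolding d_def sum_distrib_left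
      using sum.group[OF assms(1-3), of "\<lambda>j. B (\<phi> j) * c j", symmetric] by simp
    then show ?thesis by simp
  qed
  also have "\<dots> = (\<Sum>x\<in>J. cnj (d x) * (\<Sum>y\<in>J. A x y * d y))"
  proof -
    have "(\<Sum>i\<in>I. cnj (c i) * B (\<phi> i)) = (\<Sum>x\<in>J. cnj (d x) * B x)" for B
      unfolding d_def cnj_sum sum_distrib_right
      using sum.group[OF assms(1-3), of "\<lambda>i. cnj (c i) * B (\<phi> i)", symmetric] by simp
    then show ?thesis .
  qed
  also have "\<dots> = (\<Sum>x\<in>J. \<Sum>y\<in>J. cnj (d x) * A x y * d y)"
    by (simp add: sum_distrib_left mult.assoc)
  also have "0 \<le> \<dots>" using assms(4) by (simp add: psd_on_def)
  finally show "0 \<le> (\<Sum>i\<in>I. \<Sum>j\<in>I. cnj (c i) * A (\<phi> i) (\<phi> j) * c j)" .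
qed

lemma pd_pullback:
  assumes "pd S K" "\<phi> ` T \<subseteq> S"
  shows "pd T (\<lambda>x y. K (\<phi> x) (\<phi> y))"
  unfolding pd_def
proof (intro allI impI)
  fix F assume F: "finite F" "F \<subseteq> T"
  then have "\<phi> ` F \<subseteq> S" "finite (\<phi> ` F)" using assms(2) by auto
  then have "psd_on (\<phi> ` F) K" using assms(1) by (simp add: pd_def)
  then show "psd_on F (\<lambda>x y. K (\<phi> x) (\<phi> y))"
    using F by (auto intro: psd_on_reindex[where J = "\<phi> ` F" and I = F, rotated 3])
qed

lemma pd_subset: "pd S K \<Longrightarrow> T \<subseteq> S \<Longrightarrow> pd T K"
  unfolding pd_def by blast

lemma pd_cong: "pd S K \<Longrightarrow> (\<And>x y. x \<in> S \<Longrightarrow> y \<in> S \<Longrightarrow> K' x y = K x y) \<Longrightarrow> pd S K'"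
proof (rule pdI)
  fix F :: "'a set" and c assume K: "pd S K" and eq: "\<And>x y. x \<in> S \<Longrightarrow> y \<in> S \<Longrightarrow> K' x y = K x y"
    and F: "finite F" "F \<subseteq> S"
  have "(\<Sum>x\<in>F. \<Sum>y\<in>F. cnj (c x) * K' x y * c y) = (\<Sum>x\<in>F. \<Sum>y\<in>F. cnj (c x) * K x y * c y)"
    by (intro sum.cong refl) (use F eq in auto)
  then show "0 \<le> (\<Sum>x\<in>F. \<Sum>y\<in>F. cnj (c x) * K' x y * c y)"
    using pdD[OF K F, of c] by simp
qed

lemma psd_on_iff_pd:
  assumes "finite I" shows "psd_on I A \<longleftrightarrow> pd I A"
proof
  assume "psd_on I A"
  then show "pd I A"
    unfolding pd_def using psd_on_reindex[where \<phi> = "\<lambda>x. x" and A = A and J = I] assms by auto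
qed (use assms in \<open>simp add: pd_def\<close>)

lemma is_kernel_iff_pd: "is_kernel k \<longleftrightarrow> pd UNIV k"
proof
  assume k: "is_kernel k"
  show "pd UNIV k"
    unfolding pd_def
  proof (intro allI impI)
    fix F :: "'a set" assume F: "finite F"
    then obtain z where z: "bij_betw z {..<card F} F"
      using ex_bij_betw_nat_finite[OF F] by (auto simp: lessThan_atLeast0)
    have "psd_on {..<card F} (\<lambda>i j. k (z i) (z j))" using k by (simp add: is_kernel_def)
    then have "psd_on F (\<lambda>x y. k (z (inv_into {..<card F} z x)) (z (inv_into {..<card F} z y)))"
      by (rule psd_on_reindex[rotated 3])
        (use F bij_betw_inv_into[OF z] in \<open>auto simp: bij_betw_def\<close>)
    then show "psd_on F k"
      unfolding psd_on_def using z by (simp add: bij_betw_inv_into_right cong: sum.cong)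
  qed
next
  assume "pd UNIV k"
  then show "is_kernel k"
    unfolding is_kernel_def psd_on_iff_pd[OF finite_lessThan]
    by (auto intro: pd_pullback)
qed

lemma pd_add: "pd S K \<Longrightarrow> pd S L \<Longrightarrow> pd S (\<lambda>x y. K x y + L x y)"
proof (rule pdI)
  fix F :: "'a set" and c assume "pd S K" "pd S L" and F: "finite F" "F \<subseteq> S"
  then have "0 \<le> (\<Sum>x\<in>F. \<Sum>y\<in>F. cnj (c x) * K x y * c y) + (\<Sum>x\<in>F. \<Sum>y\<in>F. cnj (c x) * L x y * c y)"
    by (intro add_nonneg_nonneg pdD) auto
  then show "0 \<le> (\<Sum>x\<in>F. \<Sum>y\<in>F. cnj (c x) * (K x y + L x y) * c y)"
    by (simp add: algebra_simps sum.distrib)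
qed

lemma pd_zero: "pd S (\<lambda>x y. 0)"
  by (rule pdI) simp

lemma pd_sum: "(\<And>i. i \<in> I \<Longrightarrow> pd S (K i)) \<Longrightarrow> pd S (\<lambda>x y. \<Sum>i\<in>I. K i x y)"
  by (induction I rule: infinite_finite_induct) (auto intro: pd_zero pd_add)

lemma pd_congruence:
  assumes "pd S K"
  shows "pd S (\<lambda>x y. f x * K x y * cnj (f y))"
proof (rule pdI)
  fix F :: "'a set" and c assume F: "finite F" "F \<subseteq> S"
  have "0 \<le> (\<Sum>x\<in>F. \<Sum>y\<in>F. cnj (cnj (f x) * c x) * K x y * (cnj (f y) * c y))"
    by (rule pdD[OF assms F])
  then show "0 \<le> (\<Sum>x\<in>F. \<Sum>y\<in>F. cnj (c x) * (f x * K x y * cnj (f y)) * c y)"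
    by (simp add: mult_ac)
qed

lemma pd_const: "pd S (\<lambda>x y. 1)"
proof (rule pdI)
  fix F :: "'a set" and c :: "'a \<Rightarrow> complex"
  have "(\<Sum>x\<in>F. \<Sum>y\<in>F. cnj (c x) * 1 * c y) = cnj (sum c F) * sum c F"
    by (simp add: sum_product)
  then show "0 \<le> (\<Sum>x\<in>F. \<Sum>y\<in>F. cnj (c x) * 1 * c y)"
    by (simp only: complex_norm_square_nonneg)
qed

lemma pd_rank_one: "pd S (\<lambda>x y. f x * cnj (f y))"
  using pd_congruence[OF pd_const, of S f] by simp

lemma pd_delta: "pd S (\<lambda>x y. if x = y then 1 else 0)"
proof (rule pdI)
  fix F :: "'a set" and c :: "'a \<Rightarrow> complex" assume "finite F"
  then have "(\<Sum>x\<in>F. \<Sum>y\<in>F. cnj (c x) * (if x = y then 1 else 0) * c y) = (\<Sum>x\<in>F. cnj (c x) * c x)"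
    by (simp add: if_distrib[of "\<lambda>u. _ * u"] if_distrib[of "\<lambda>u. u * _"] sum.delta cong: if_cong)
  then show "0 \<le> (\<Sum>x\<in>F. \<Sum>y\<in>F. cnj (c x) * (if x = y then 1 else 0) * c y)"
    by (simp only: sum_nonneg complex_norm_square_nonneg)
qed

lemma pd_diag_nonneg: "pd S K \<Longrightarrow> x \<in> S \<Longrightarrow> 0 \<le> K x x"
  using pdD[of S K "{x}" "\<lambda>_. 1"] by simp

lemma pd_hermitian:
  assumes "pd S K" "x \<in> S" "y \<in> S"
  shows "K y x = cnj (K x y)"
proof (cases "x = y")
  case True
  then show ?thesis using pd_diag_nonneg[OF assms(1,2)]
    by (simp add: less_eq_complex_def complex_eq_iff)
next
  case False
  have d: "Im (K x x) = 0" "Im (K y y) = 0"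
    using pd_diag_nonneg[OF assms(1)] assms(2,3) by (auto simp: less_eq_complex_def)
  have "0 \<le> (\<Sum>u\<in>{x,y}. \<Sum>v\<in>{x,y}. cnj (1) * K u v * 1)"
    by (rule pdD[OF assms(1)]) (use assms in auto)
  then have "Im (K x y) + Im (K y x) = 0"
    using False d by (auto simp: less_eq_complex_def)
  moreover have "0 \<le> (\<Sum>u\<in>{x,y}. \<Sum>v\<in>{x,y}. cnj (if u = x then 1 else \<i>) * K u v * (if v = x then 1 else \<i>))"
    by (rule pdD[OF assms(1)]) (use assms in auto)
  then have "Re (K x y) = Re (K y x)"
    using False d by (auto simp: less_eq_complex_def)
  ultimately show ?thesis by (simp add: complex_eq_iff)
qed

lemma pd_diag_real:
  assumes "pd S K" "x \<in> S"
  shows "K x x = of_real (Re (K x x))" "0 \<le> Re (K x x)"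
  using pd_diag_nonneg[OF assms] by (auto simp: less_eq_complex_def complex_eq_iff)

text \<open>The form of the Schur complement at \<open>c\<close> is the minimum of the form of \<open>K\<close> over all \<open>c - t e\<^sub>z\<close>,
attained at \<open>t = (\<Sum>y. K z y * c y) / K z z\<close>. If \<open>K z z = 0\<close>, the subtracted term is \<open>0\<close> because
division by zero yields zero.\<close>

lemma pd_schur_complement:
  assumes K: "pd S K" and z: "z \<in> S"
  shows "pd S (\<lambda>x y. K x y - K x z * K z y / K z z)"
proof (cases "K z z = 0")
  case True
  then show ?thesis using K by simp
next
  case False
  show ?thesis
  proof (rule pdI)
    fix F :: "'a set" and c :: "'a \<Rightarrow> complex" assume F: "finite F" "F \<subseteq> S"
    define G where "G = insert z F"
    define e where "e x = (if x \<in> F then c x else 0)" for x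
    define u where "u = (\<Sum>y\<in>F. K z y * c y)"
    define t where "t = u / K z z"
    have G: "finite G" "G \<subseteq> S" "z \<in> G" "F \<subseteq> G" using F z by (auto simp: G_def)
    have u: "(\<Sum>y\<in>G. K z y * e y) = u"
      unfolding u_def e_def by (rule sum.mono_neutral_cong_right) (use G in auto)
    have u': "(\<Sum>x\<in>G. cnj (e x) * K x z) = cnj u"
      unfolding u[symmetric] cnj_sum
      by (rule sum.cong) (use G pd_hermitian[OF K z] in \<open>auto simp: mult.commute\<close>)
    have u'': "(\<Sum>x\<in>F. cnj (c x) * K x z) = cnj u"
      unfolding u_def cnj_sum
      by (rule sum.cong) (use F pd_hermitian[OF K z] in \<open>auto simp: mult.commute\<close>)
    have real: "cnj (K z z) = K z z" using pd_diag_real(1)[OF K z] by (metis complex_cnj_complex_of_real)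
    have "0 \<le> (\<Sum>x\<in>G. \<Sum>y\<in>G. cnj (e x - (if x = z then t else 0)) * K x y * (e y - (if y = z then t else 0)))"
      by (rule pdD[OF K G(1,2)])
    also have "\<dots> = (\<Sum>x\<in>G. cnj (e x - (if x = z then t else 0)) * ((\<Sum>y\<in>G. K x y * e y) - K x z * t))"
    proof (rule sum.cong[OF refl])
      fix x
      have "(\<Sum>y\<in>G. K x y * (e y - (if y = z then t else 0))) = (\<Sum>y\<in>G. K x y * e y) - K x z * t"
        using G by (simp add: right_diff_distrib sum_subtractf if_distrib[of "\<lambda>u. _ * u"] cong: if_cong)
      then show "(\<Sum>y\<in>G. cnj (e x - (if x = z then t else 0)) * K x y * (e y - (if y = z then t else 0)))
        = cnj (e x - (if x = z then t else 0)) * ((\<Sum>y\<in>G. K x y * e y) - K x z * t)"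
        by (simp add: mult.assoc flip: sum_distrib_left)
    qed
    also have "\<dots> = (\<Sum>x\<in>G. cnj (e x) * ((\<Sum>y\<in>G. K x y * e y) - K x z * t)) - cnj t * (u - K z z * t)"
      using G u by (simp add: left_diff_distrib sum_subtractf if_distrib[of "\<lambda>u. u * _"] if_distrib[of cnj] cong: if_cong)
    also have "u - K z z * t = 0" using False by (simp add: t_def)
    also have "(\<Sum>x\<in>G. cnj (e x) * ((\<Sum>y\<in>G. K x y * e y) - K x z * t))
       = (\<Sum>x\<in>G. \<Sum>y\<in>G. cnj (e x) * K x y * e y) - (\<Sum>x\<in>G. cnj (e x) * K x z) * t"
      by (simp add: right_diff_distrib sum_subtractf sum_distrib_left sum_distrib_right mult.assoc)
    also have "(\<Sum>x\<in>G. \<Sum>y\<in>G. cnj (e x) * K x y * e y) = (\<Sum>x\<in>F. \<Sum>y\<in>F. cnj (c x) * K x y * c y)"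
      unfolding e_def by (rule form_extend) (use G in auto)
    finally have *: "0 \<le> (\<Sum>x\<in>F. \<Sum>y\<in>F. cnj (c x) * K x y * c y) - cnj u * t"
      using u' by simp
    have "(\<Sum>x\<in>F. \<Sum>y\<in>F. cnj (c x) * (K x z * K z y / K z z) * c y)
        = (\<Sum>x\<in>F. cnj (c x) * K x z) * (\<Sum>y\<in>F. K z y * c y) / K z z"
      by (simp only: sum_product sum_divide_distrib) (simp add: mult_ac)
    also have "\<dots> = cnj u * t" using u'' by (simp add: u_def t_def)
    finally have "(\<Sum>x\<in>F. \<Sum>y\<in>F. cnj (c x) * (K x y - K x z * K z y / K z z) * c y)
       = (\<Sum>x\<in>F. \<Sum>y\<in>F. cnj (c x) * K x y * c y) - cnj u * t"
      by (simp add: algebra_simps sum_subtractf)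
    with * show "0 \<le> (\<Sum>x\<in>F. \<Sum>y\<in>F. cnj (c x) * (K x y - K x z * K z y / K z z) * c y)" by simp
  qed
qed

text \<open>Otherwise a large multiple of \<open>e\<^sub>z\<close> added to \<open>e\<^sub>x\<close> would make the form negative.\<close>

lemma pd_zero_diag:
  assumes K: "pd S K" and "x \<in> S" "z \<in> S" "K z z = 0"
  shows "K x z = 0"
proof (rule ccontr)
  assume n: "K x z \<noteq> 0"
  define r where "r = Re (K x x) + 1"
  have r: "r > 0" "K x x = of_real (r - 1)" using pd_diag_real[OF K assms(2)] by (simp_all add: r_def)
  have ne: "x \<noteq> z" using n assms by auto
  define t where "t = - of_real r * cnj (K x z) / (of_real (norm (K x z)))^2"
  have h: "K z x = cnj (K x z)" using pd_hermitian[OF K assms(2,3)] .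
  have tt: "K x z * t = - of_real r"
    using n by (simp add: t_def complex_norm_square[symmetric] divide_simps del: complex_cnj_mult)
  have "0 \<le> (\<Sum>u\<in>{x,z}. \<Sum>v\<in>{x,z}. cnj (if u = x then 1 else t) * K u v * (if v = x then 1 else t))"
    by (rule pdD[OF K]) (use assms in auto)
  also have "\<dots> = K x x + K x z * t + cnj (K x z * t)"
    using ne assms(4) h by (auto simp: mult.commute)
  also have "\<dots> = of_real (-1 - r)" unfolding tt r(2) by simp
  finally show False using r(1) by (simp add: less_eq_complex_def)
qed

lemma pd_cauchy_schwarz:
  assumes K: "pd S K" and x: "x \<in> S" and z: "z \<in> S"
  shows "(norm (K x z))\<^sup>2 \<le> Re (K x x) * Re (K z z)"
proof (cases "K z z = 0")
  case True
  then show ?thesis using pd_zero_diag[OF K x z] by simp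
next
  case False
  have pos: "Re (K z z) > 0" using False pd_diag_real[OF K z]
    by (metis less_eq_real_def of_real_0)
  have "0 \<le> K x x - K x z * K z x / K z z"
    using pd_diag_nonneg[OF pd_schur_complement[OF K z] x] .
  also have "K x z * K z x = of_real ((norm (K x z))\<^sup>2)"
    using pd_hermitian[OF K x z] by (simp add: complex_norm_square del: of_real_power)
  finally have "0 \<le> Re (K x x) - (norm (K x z))\<^sup>2 / Re (K z z)"
    using pd_diag_real(1)[OF K z] 
    by (metis Re_complex_of_real less_eq_complex_def minus_complex.simps(1) of_real_divide zero_complex.simps(1))
  then show ?thesis using pos by (simp add: field_simps)
qed

text \<open>Cholesky factorization: taking Schur complements at the points of \<open>T\<close> one after the other splits
off rank-one kernels, and the remainder has vanishing rows at all points treated so far. The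
remainder stays positive on the whole of \<open>S\<close>, which is what lets a kernel be replaced by a kernel of
finite rank with the same values on \<open>S \<times> T\<close>.\<close>

lemma pd_factor:
  assumes K: "pd S K" and T: "finite T" "T \<subseteq> S"
  shows "\<exists>(m::nat) v. pd S (\<lambda>x y. K x y - (\<Sum>i<m. v i x * cnj (v i y))) \<and>
      (\<forall>x\<in>S. \<forall>t\<in>T. K x t = (\<Sum>i<m. v i x * cnj (v i t)))"
  using T
proof (induction T rule: finite_induct)
  case empty
  show ?case by (rule exI[of _ 0]) (use K in auto)
next
  case (insert z T)
  then obtain m :: nat and v where R: "pd S (\<lambda>x y. K x y - (\<Sum>i<m. v i x * cnj (v i y)))"
    and Rz: "\<forall>x\<in>S. \<forall>t\<in>T. K x t = (\<Sum>i<m. v i x * cnj (v i t))" by auto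
  define R where "R x y = K x y - (\<Sum>i<m. v i x * cnj (v i y))" for x y
  have Rpd: "pd S R" using R unfolding R_def .
  have zS: "z \<in> S" using insert by auto
  have R0: "R x t = 0" if "x \<in> S" "t \<in> T" for x t using Rz that by (simp add: R_def)
  define r where "r = sqrt (Re (R z z))"
  have rr: "R z z = of_real r * of_real r"
    using pd_diag_real[OF Rpd zS] by (simp add: r_def flip: of_real_mult)
  define w where "w x = R x z / of_real r" for x
  define v' where "v' = v(m := w)"
  have w: "R x z * R z y / R z z = w x * cnj (w y)" if "x \<in> S" "y \<in> S" for x y
    using pd_hermitian[OF Rpd that(2) zS] rr by (simp add: w_def)
  have s: "(\<Sum>i<Suc m. v' i x * cnj (v' i y)) = (\<Sum>i<m. v i x * cnj (v i y)) + w x * cnj (w y)" for x y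
    by (simp add: v'_def)
  have "pd S (\<lambda>x y. K x y - (\<Sum>i<Suc m. v' i x * cnj (v' i y)))"
    by (rule pd_cong[OF pd_schur_complement[OF Rpd zS]]) (simp only: w s, simp only: R_def diff_diff_eq)
  moreover have "K x t = (\<Sum>i<Suc m. v' i x * cnj (v' i t))" if "x \<in> S" "t \<in> insert z T" for x t
  proof -
    have tS: "t \<in> S" using that insert by auto
    have "R x t = R x z * R z t / R z z"
    proof (cases "t = z")
      case True
      then show ?thesis using pd_zero_diag[OF Rpd that(1) zS] by auto
    next
      case False
      then show ?thesis using R0 that zS by auto
    qed
    then have "K x t - (\<Sum>i<m. v i x * cnj (v i t)) = w x * cnj (w t)"
      unfolding w[OF that(1) tS] R_def[of x t] .
    then show ?thesis unfolding s by (simp add: diff_eq_eq add.commute)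
  qed
  ultimately show ?case by blast
qed

lemma pd_factor_finite:
  assumes "finite F" "pd F K"
  obtains m :: nat and v where "\<And>x y. x \<in> F \<Longrightarrow> y \<in> F \<Longrightarrow> K x y = (\<Sum>i<m. v i x * cnj (v i y))"
  using pd_factor[OF assms(2,1) subset_refl] by blast

text \<open>Schur product theorem: writing \<open>K\<close> as a finite sum of rank-one kernels reduces it to congruences
of \<open>L\<close>.\<close>

lemma pd_mult:
  assumes K: "pd S K" and L: "pd S L"
  shows "pd S (\<lambda>x y. K x y * L x y)"
  unfolding pd_def
proof (intro allI impI)
  fix F assume F: "finite F" "F \<subseteq> S"
  obtain m :: nat and v where v: "\<And>x y. x \<in> F \<Longrightarrow> y \<in> F \<Longrightarrow> K x y = (\<Sum>i<m. v i x * cnj (v i y))"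
    using pd_factor_finite[OF F(1) pd_subset[OF K F(2)]] by metis
  have "pd F (\<lambda>x y. \<Sum>i<m. v i x * L x y * cnj (v i y))"
    by (intro pd_sum pd_congruence pd_subset[OF L F(2)])
  then have "pd F (\<lambda>x y. K x y * L x y)"
    by (rule pd_cong) (simp add: v sum_distrib_left sum_distrib_right mult_ac)
  then show "psd_on F (\<lambda>x y. K x y * L x y)" using F by (simp add: psd_on_iff_pd)
qed

lemma pd_limit:
  assumes "\<And>n::nat. pd S (K n)" "\<And>x y. x \<in> S \<Longrightarrow> y \<in> S \<Longrightarrow> (\<lambda>n. K n x y) \<longlonglongrightarrow> L x y"
  shows "pd S L"
proof (rule pdI)
  fix F :: "'a set" and c assume F: "finite F" "F \<subseteq> S"
  have lim: "(\<lambda>n. \<Sum>x\<in>F. \<Sum>y\<in>F. cnj (c x) * K n x y * c y) \<longlonglongrightarrow> (\<Sum>x\<in>F. \<Sum>y\<in>F. cnj (c x) * L x y * c y)"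
    by (intro tendsto_sum tendsto_mult tendsto_const assms(2)) (use F in auto)
  have nn: "0 \<le> (\<Sum>x\<in>F. \<Sum>y\<in>F. cnj (c x) * K n x y * c y)" for n
    by (rule pdD[OF assms(1) F])
  have "0 \<le> Re (\<Sum>x\<in>F. \<Sum>y\<in>F. cnj (c x) * L x y * c y)"
    by (rule LIMSEQ_le_const[OF tendsto_Re[OF lim]]) (use nn in \<open>auto simp: less_eq_complex_def\<close>)
  moreover have "Im (\<Sum>x\<in>F. \<Sum>y\<in>F. cnj (c x) * L x y * c y) = 0"
  proof (rule LIMSEQ_unique[OF tendsto_Im[OF lim]])
    show "(\<lambda>n. Im (\<Sum>x\<in>F. \<Sum>y\<in>F. cnj (c x) * K n x y * c y)) \<longlonglongrightarrow> 0"
      using nn by (simp add: less_eq_complex_def)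
  qed
  ultimately show "0 \<le> (\<Sum>x\<in>F. \<Sum>y\<in>F. cnj (c x) * L x y * c y)"
    by (simp add: less_eq_complex_def)
qed

lemma pd_norm_less_1:
  assumes p: "pd S p" and lt: "\<And>x. x \<in> S \<Longrightarrow> Re (p x x) < 1" and "x \<in> S" "y \<in> S"
  shows "norm (p x y) < 1"
proof -
  have "(norm (p x y))\<^sup>2 \<le> Re (p x x) * Re (p y y)" using pd_cauchy_schwarz[OF p assms(3,4)] .
  also have "\<dots> \<le> Re (p x x) * 1"
    by (intro mult_left_mono less_imp_le lt pd_diag_real(2)[OF p] assms)
  also have "\<dots> < 1" using lt assms by simp
  finally show ?thesis by (simp add: power_less_one_iff abs_square_less_1)
qed

text \<open>A geometric series of Schur powers; it converges because \<open>p\<close> is less than \<open>1\<close> in modulus off the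
diagonal as well, by the Cauchy--Schwarz inequality.\<close>

lemma pd_inverse_one_minus:
  assumes p: "pd S p" and lt: "\<And>x. x \<in> S \<Longrightarrow> Re (p x x) < 1"
  shows "pd S (\<lambda>x y. 1 / (1 - p x y))"
proof (rule pd_limit)
  have "pd S (\<lambda>x y. p x y ^ i)" for i
    by (induction i) (auto intro: pd_const pd_mult p)
  then show "pd S (\<lambda>x y. \<Sum>i<n. p x y ^ i)" for n by (intro pd_sum)
  show "(\<lambda>n. \<Sum>i<n. p x y ^ i) \<longlonglongrightarrow> 1 / (1 - p x y)" if "x \<in> S" "y \<in> S" for x y
    using geometric_sums[OF pd_norm_less_1[OF p lt that]] by (simp add: sums_def)
qed

lemma pd_kernel_at: "pd UNIV K \<Longrightarrow> pd UNIV (kernel_at K z)"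
  unfolding kernel_at_def by (rule pd_schur_complement) auto

lemma pd_column: 
  assumes "pd UNIV K"
  shows "pd UNIV (\<lambda>x y. K x z * K z y / K z z)"
proof -
  have "pd UNIV (\<lambda>x y. (K x z / of_real (sqrt (Re (K z z)))) * cnj (K y z / of_real (sqrt (Re (K z z)))))"
    by (rule pd_rank_one)
  then show ?thesis
  proof (rule pd_cong)
    fix x y
    have "K z z = of_real (sqrt (Re (K z z))) * of_real (sqrt (Re (K z z)))"
      using pd_diag_real[OF assms, of z] by (simp flip: of_real_mult)
    then show "K x z * K z y / K z z = (K x z / of_real (sqrt (Re (K z z)))) * cnj (K y z / of_real (sqrt (Re (K z z))))"
      using pd_hermitian[OF assms, of y z] by simp
  qed
qed

lemma sum_swap_pairs:
  "(\<Sum>x\<in>A. \<Sum>y\<in>B. \<Sum>i\<in>I. \<Sum>j\<in>J. g x y i j) = (\<Sum>i\<in>I. \<Sum>j\<in>J. \<Sum>x\<in>A. \<Sum>y\<in>B. g x y i j)"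
proof -
  have "(\<Sum>p\<in>A \<times> B. \<Sum>q\<in>I \<times> J. g (fst p) (snd p) (fst q) (snd q))
      = (\<Sum>q\<in>I \<times> J. \<Sum>p\<in>A \<times> B. g (fst p) (snd p) (fst q) (snd q))"
    by (rule sum.swap)
  then show ?thesis by (simp only: sum.cartesian_product' fst_conv snd_conv)
qed

text \<open>The Gram matrix of any family of finitely supported vectors with respect to the form of \<open>k\<close>. With
two vectors it provides the Cauchy--Schwarz inequality for that form.\<close>

lemma pd_form:
  fixes k :: "'a \<Rightarrow> 'a \<Rightarrow> complex" and C :: "'b \<Rightarrow> 'a \<Rightarrow> complex"
  assumes k: "pd UNIV k" and F: "finite F"
  shows "pd UNIV (\<lambda>i j. \<Sum>x\<in>F. \<Sum>y\<in>F. cnj (C i x) * k x y * C j y)"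
proof (rule pdI)
  fix I :: "'b set" and t :: "'b \<Rightarrow> complex" assume I: "finite I"
  define e where "e x = (\<Sum>i\<in>I. C i x * t i)" for x
  have "0 \<le> (\<Sum>x\<in>F. \<Sum>y\<in>F. cnj (e x) * k x y * e y)" by (rule pdD[OF k F]) simp
  also have "\<dots> = (\<Sum>x\<in>F. \<Sum>y\<in>F. \<Sum>i\<in>I. \<Sum>j\<in>I. cnj (t i) * (cnj (C i x) * k x y * C j y) * t j)"
  proof (intro sum.cong refl)
    fix x y
    have "cnj (e x) * k x y = (\<Sum>i\<in>I. cnj (t i) * cnj (C i x) * k x y)"
      by (simp add: e_def sum_distrib_left sum_distrib_right mult.commute)
    then show "cnj (e x) * k x y * e y = (\<Sum>i\<in>I. \<Sum>j\<in>I. cnj (t i) * (cnj (C i x) * k x y * C j y) * t j)"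
      by (simp only: e_def sum_product) (simp add: mult.assoc)
  qed
  also have "\<dots> = (\<Sum>i\<in>I. \<Sum>j\<in>I. \<Sum>x\<in>F. \<Sum>y\<in>F. cnj (t i) * (cnj (C i x) * k x y * C j y) * t j)"
    by (rule sum_swap_pairs)
  finally show "0 \<le> (\<Sum>i\<in>I. \<Sum>j\<in>I. cnj (t i) * (\<Sum>x\<in>F. \<Sum>y\<in>F. cnj (C i x) * k x y * C j y) * t j)"
    by (simp add: sum_distrib_left sum_distrib_right)
qed

section \<open>Contractions between finite-dimensional spaces\<close>

text \<open>Vectors are functions on a finite index set, so that index sets can be built as disjoint unions and
products without any change of type.\<close>

definition dotc :: "'i set \<Rightarrow> ('i \<Rightarrow> complex) \<Rightarrow> ('i \<Rightarrow> complex) \<Rightarrow> complex" where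
  "dotc I f g = (\<Sum>i\<in>I. f i * cnj (g i))"

lemma dotc_add_left: "dotc I (\<lambda>i. f i + g i) h = dotc I f h + dotc I g h"
  by (simp add: dotc_def distrib_right sum.distrib)

lemma dotc_diff_left: "dotc I (\<lambda>i. f i - g i) h = dotc I f h - dotc I g h"
  by (simp add: dotc_def left_diff_distrib sum_subtractf)

lemma dotc_scale_left: "dotc I (\<lambda>i. c * f i) h = c * dotc I f h"
  by (simp add: dotc_def sum_distrib_left mult.assoc)

lemma dotc_sum_left: "dotc I (\<lambda>i. \<Sum>j\<in>J. f j i) h = (\<Sum>j\<in>J. dotc I (f j) h)"
  unfolding dotc_def sum_distrib_right by (rule sum.swap)

lemma dotc_commute: "dotc I g f = cnj (dotc I f g)"
  by (simp add: dotc_def mult.commute)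

lemma dotc_diff_right: "dotc I h (\<lambda>i. f i - g i) = dotc I h f - dotc I h g"
  by (simp add: dotc_def right_diff_distrib sum_subtractf)

lemma dotc_lincomb_right: "dotc I h (\<lambda>i. \<Sum>j\<in>J. c j * f j i) = (\<Sum>j\<in>J. cnj (c j) * dotc I h (f j))"
  unfolding dotc_commute[of I h] dotc_sum_left dotc_scale_left by simp

lemma dotc_lincomb_left: "dotc I (\<lambda>i. \<Sum>j\<in>J. c j * f j i) h = (\<Sum>j\<in>J. c j * dotc I (f j) h)"
  unfolding dotc_sum_left dotc_scale_left ..

lemma dotc_cong: "(\<And>i. i \<in> I \<Longrightarrow> f i = f' i) \<Longrightarrow> (\<And>i. i \<in> I \<Longrightarrow> g i = g' i) \<Longrightarrow> dotc I f g = dotc I f' g'"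
  by (simp add: dotc_def)

lemma dotc_self: "dotc I f f = of_real (\<Sum>i\<in>I. (norm (f i))\<^sup>2)"
  by (simp add: dotc_def complex_norm_square del: of_real_power)

lemma dotc_self_nonneg: "0 \<le> Re (dotc I f f)"
  by (simp add: dotc_self sum_nonneg)

lemma dotc_self_zero: "finite I \<Longrightarrow> Re (dotc I f f) = 0 \<Longrightarrow> i \<in> I \<Longrightarrow> f i = 0"
  by (simp add: dotc_self sum_nonneg_eq_0_iff)

text \<open>Gram--Schmidt: a new vector \<open>X a\<close> is first replaced by its component \<open>e\<close> orthogonal to the others.\<close>

lemma orthogonal_projection_exists:
  assumes I: "finite I" and J: "finite J"
  shows "\<exists>c. \<forall>j\<in>J. dotc I (\<lambda>i. f i - (\<Sum>j'\<in>J. c j' * X j' i)) (X j) = 0"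
  using J
proof (induction J arbitrary: f rule: finite_induct)
  case empty
  then show ?case by simp
next
  case (insert a J)
  obtain d where d: "\<forall>j\<in>J. dotc I (\<lambda>i. X a i - (\<Sum>j'\<in>J. d j' * X j' i)) (X j) = 0"
    using insert.IH by blast
  obtain c where c: "\<forall>j\<in>J. dotc I (\<lambda>i. f i - (\<Sum>j'\<in>J. c j' * X j' i)) (X j) = 0"
    using insert.IH by blast
  define e where "e i = X a i - (\<Sum>j'\<in>J. d j' * X j' i)" for i
  define r where "r i = f i - (\<Sum>j'\<in>J. c j' * X j' i)" for i
  define t where "t = dotc I r e / dotc I e e"
  define c' where "c' j = (if j = a then t else c j - t * d j)" for j
  have eJ: "dotc I e (X j) = 0" if "j \<in> J" for j using d that unfolding e_def[abs_def] by blast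
  have rJ: "dotc I r (X j) = 0" if "j \<in> J" for j using c that unfolding r_def[abs_def] by blast
  have res: "f i - (\<Sum>j'\<in>insert a J. c' j' * X j' i) = r i - t * e i" for i
  proof -
    have "(\<Sum>j'\<in>J. c' j' * X j' i) = (\<Sum>j'\<in>J. (c j' - t * d j') * X j' i)"
      by (rule sum.cong) (use insert in \<open>auto simp: c'_def\<close>)
    then show ?thesis using insert(1,2)
      by (simp add: c'_def r_def e_def algebra_simps sum_subtractf sum_distrib_left)
  qed
  have te: "dotc I r e - t * dotc I e e = 0"
  proof (cases "dotc I e e = 0")
    case True
    then have "e i = 0" if "i \<in> I" for i using dotc_self_zero[OF I _ that] by simp
    then have "dotc I r e = 0" by (simp add: dotc_def)
    then show ?thesis using True by simp
  qed (simp add: t_def)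
  have rtJ: "dotc I (\<lambda>i. r i - t * e i) (X j) = 0" if "j \<in> J" for j
    using eJ[OF that] rJ[OF that] by (simp add: dotc_diff_left dotc_scale_left)
  have "dotc I (\<lambda>i. r i - t * e i) e = 0"
    using te by (simp add: dotc_diff_left dotc_scale_left)
  moreover have "dotc I (\<lambda>i. r i - t * e i) e
     = dotc I (\<lambda>i. r i - t * e i) (X a) - (\<Sum>j\<in>J. cnj (d j) * dotc I (\<lambda>i. r i - t * e i) (X j))"
    unfolding e_def[abs_def] dotc_diff_right dotc_lincomb_right ..
  ultimately have "dotc I (\<lambda>i. r i - t * e i) (X a) = 0"
    using rtJ by simp
  then have "\<forall>j\<in>insert a J. dotc I (\<lambda>i. f i - (\<Sum>j'\<in>insert a J. c' j' * X j' i)) (X j) = 0"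
    unfolding res using rtJ by blast
  then show ?case by blast
qed

definition contraction_on :: "'i set \<Rightarrow> 'o set \<Rightarrow> ('o \<Rightarrow> 'i \<Rightarrow> complex) \<Rightarrow> bool" where
  "contraction_on I R V \<longleftrightarrow>
     (\<forall>f. Re (dotc R (\<lambda>r. \<Sum>i\<in>I. V r i * f i) (\<lambda>r. \<Sum>i\<in>I. V r i * f i)) \<le> Re (dotc I f f))"

text \<open>The lurking isometry: \<open>X j \<mapsto> Y j\<close> extends to an isometry from the span of the \<open>X j\<close> to the
span of the \<open>Y j\<close>, and composing with the orthogonal projection gives a contraction on
the whole space.\<close>

lemma contraction_of_equal_gram:
  fixes X :: "'j \<Rightarrow> 'i \<Rightarrow> complex" and Y :: "'j \<Rightarrow> 'o \<Rightarrow> complex"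
  assumes I: "finite I" and R: "finite R" and J: "finite J"
    and gram: "\<And>i j. i \<in> J \<Longrightarrow> j \<in> J \<Longrightarrow> dotc I (X i) (X j) = dotc R (Y i) (Y j)"
  shows "\<exists>V. contraction_on I R V \<and> (\<forall>j\<in>J. \<forall>r\<in>R. (\<Sum>i\<in>I. V r i * X j i) = Y j r)"
proof -
  have "\<forall>i. \<exists>c. \<forall>j\<in>J. dotc I (\<lambda>i'. (if i' = i then 1 else 0) - (\<Sum>j'\<in>J. c j' * X j' i')) (X j) = 0"
    using orthogonal_projection_exists[OF I J] by (rule allI)
  from choice[OF this] obtain C where C: "\<And>i j. j \<in> J \<Longrightarrow>
      dotc I (\<lambda>i'. (if i' = i then 1 else 0) - (\<Sum>j'\<in>J. C i j' * X j' i')) (X j) = 0"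
    by auto
  define V where "V r i = (\<Sum>j\<in>J. C i j * Y j r)" for r i
  define \<gamma> where "\<gamma> f j = (\<Sum>i\<in>I. f i * C i j)" for f j
  have Vf: "(\<Sum>i\<in>I. V r i * f i) = (\<Sum>j\<in>J. \<gamma> f j * Y j r)" for r f
    unfolding V_def \<gamma>_def sum_distrib_right
    by (subst sum.swap) (simp add: mult_ac)
  have orth: "dotc I (\<lambda>i. f i - (\<Sum>j\<in>J. \<gamma> f j * X j i)) (X j0) = 0" if j0: "j0 \<in> J" for f j0
  proof -
    have "f i' - (\<Sum>j\<in>J. \<gamma> f j * X j i')
        = (\<Sum>i\<in>I. f i * ((if i' = i then 1 else 0) - (\<Sum>j'\<in>J. C i j' * X j' i')))" if "i' \<in> I" for i'
    proof -
      have "(\<Sum>j\<in>J. \<gamma> f j * X j i') = (\<Sum>i\<in>I. f i * (\<Sum>j'\<in>J. C i j' * X j' i'))"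
        unfolding \<gamma>_def sum_distrib_right sum_distrib_left
        by (subst sum.swap) (simp add: mult_ac)
      moreover have "(\<Sum>i\<in>I. f i * (if i' = i then 1 else 0)) = f i'"
        using that I by (simp add: if_distrib[of "\<lambda>u. _ * u"] cong: if_cong)
      ultimately show ?thesis by (simp add: right_diff_distrib sum_subtractf)
    qed
    then have "dotc I (\<lambda>i. f i - (\<Sum>j\<in>J. \<gamma> f j * X j i)) (X j0)
       = dotc I (\<lambda>i'. \<Sum>i\<in>I. f i * ((if i' = i then 1 else 0) - (\<Sum>j'\<in>J. C i j' * X j' i'))) (X j0)"
      by (intro dotc_cong) auto
    also have "\<dots> = 0" unfolding dotc_lincomb_left using C[OF j0] by simp
    finally show ?thesis .
  qed
  \<comment> \<open>By equality of the Gram matrices, a linear relation among the \<open>X j\<close> holds among the \<open>Y j\<close> as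
    well; hence the choice of the projection coefficients \<open>C\<close> does not matter.\<close>
  have iso: "dotc I (\<lambda>i. \<Sum>j\<in>J. g j * X j i) (\<lambda>i. \<Sum>j\<in>J. g j * X j i)
     = dotc R (\<lambda>r. \<Sum>j\<in>J. g j * Y j r) (\<lambda>r. \<Sum>j\<in>J. g j * Y j r)" for g
    unfolding dotc_lincomb_left dotc_lincomb_right using gram by (simp cong: sum.cong)
  have "contraction_on I R V"
    unfolding contraction_on_def
  proof
    fix f
    define h where "h i = (\<Sum>j\<in>J. \<gamma> f j * X j i)" for i
    define r where "r i = f i - h i" for i
    have rh: "dotc I r h = 0" unfolding h_def[abs_def] dotc_lincomb_right
      using orth[of _ f] unfolding r_def[abs_def] h_def by simp
    have hr: "dotc I h r = 0" using dotc_commute[of I h r] rh by simp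
    have f: "f = (\<lambda>i. r i + h i)" by (simp add: r_def)
    have "dotc I f r = dotc I r r" "dotc I f h = dotc I h h"
      using rh hr unfolding f dotc_add_left by simp_all
    then have "dotc I r f = dotc I r r" "dotc I h f = dotc I h h"
      using dotc_commute[of I r f] dotc_commute[of I h f] dotc_commute[of I r r] dotc_commute[of I h h]
      by simp_all
    moreover have "dotc I f f = dotc I r f + dotc I h f"
      by (subst (1) f) (rule dotc_add_left)
    ultimately have "Re (dotc I f f) = Re (dotc I r r) + Re (dotc I h h)" by simp
    then have "Re (dotc I h h) \<le> Re (dotc I f f)" using dotc_self_nonneg[of I r] by simp
    then show "Re (dotc R (\<lambda>r. \<Sum>i\<in>I. V r i * f i) (\<lambda>r. \<Sum>i\<in>I. V r i * f i)) \<le> Re (dotc I f f)"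
      unfolding Vf iso[symmetric] h_def .
  qed
  moreover have "(\<Sum>i\<in>I. V r i * X j0 i) = Y j0 r" if j0: "j0 \<in> J" and r: "r \<in> R" for j0 r
  proof -
    define \<delta> where "\<delta> j = (if j = j0 then 1 else 0) - \<gamma> (X j0) j" for j
    have d: "(\<Sum>j\<in>J. \<delta> j * Z j) = Z j0 - (\<Sum>j\<in>J. \<gamma> (X j0) j * Z j)" for Z :: "'j \<Rightarrow> complex"
      using j0 J by (simp add: \<delta>_def left_diff_distrib sum_subtractf if_distrib[of "\<lambda>u. u * _"] cong: if_cong)
    have "dotc I (\<lambda>i. \<Sum>j\<in>J. \<delta> j * X j i) (\<lambda>i. \<Sum>j\<in>J. \<delta> j * X j i) = 0"
      unfolding dotc_lincomb_right unfolding d using orth by simp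
    then have "Re (dotc R (\<lambda>r. \<Sum>j\<in>J. \<delta> j * Y j r) (\<lambda>r. \<Sum>j\<in>J. \<delta> j * Y j r)) = 0"
      using iso by simp
    from dotc_self_zero[OF R this r] show ?thesis unfolding Vf d by simp
  qed
  ultimately show ?thesis by blast
qed

lemma pd_gram_contraction:
  assumes V: "contraction_on I R V"
    and Y: "\<And>x r. x \<in> S \<Longrightarrow> r \<in> R \<Longrightarrow> Y x r = (\<Sum>i\<in>I. V r i * X x i)"
  shows "pd S (\<lambda>x y. dotc I (X x) (X y) - dotc R (Y x) (Y y))"
proof (rule pdI)
  fix F c assume F: "finite F" "F \<subseteq> S"
  define f where "f i = (\<Sum>x\<in>F. cnj (c x) * X x i)" for i
  define g where "g r = (\<Sum>x\<in>F. cnj (c x) * Y x r)" for r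
  have g: "g r = (\<Sum>i\<in>I. V r i * f i)" if "r \<in> R" for r
  proof -
    have "g r = (\<Sum>x\<in>F. cnj (c x) * (\<Sum>i\<in>I. V r i * X x i))"
      unfolding g_def by (rule sum.cong) (use F Y that in auto)
    then show ?thesis unfolding f_def sum_distrib_left
      by (subst sum.swap) (simp add: mult_ac)
  qed
  have "dotc R g g = dotc R (\<lambda>r. \<Sum>i\<in>I. V r i * f i) (\<lambda>r. \<Sum>i\<in>I. V r i * f i)"
    by (rule dotc_cong) (auto simp: g)
  then have "Re (dotc R g g) \<le> Re (dotc I f f)" using V by (simp add: contraction_on_def)
  then have "0 \<le> dotc I f f - dotc R g g" by (simp add: dotc_self less_eq_complex_def)
  also have "dotc I f f - dotc R g g = (\<Sum>x\<in>F. \<Sum>y\<in>F. cnj (c x) * (dotc I (X x) (X y) - dotc R (Y x) (Y y)) * c y)"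
    unfolding f_def[abs_def] g_def[abs_def] dotc_lincomb_left unfolding dotc_lincomb_right
    by (simp add: right_diff_distrib left_diff_distrib sum_subtractf sum_distrib_left mult_ac)
  finally show "0 \<le> (\<Sum>x\<in>F. \<Sum>y\<in>F. cnj (c x) * (dotc I (X x) (X y) - dotc R (Y x) (Y y)) * c y)" .
qed

lemma strict_contraction_unique:
  assumes I: "finite I" and q: "q < 1"
    and M: "\<And>f. Re (dotc I (\<lambda>i. \<Sum>j\<in>I. M i j * f j) (\<lambda>i. \<Sum>j\<in>I. M i j * f j)) \<le> q * Re (dotc I f f)"
    and f: "\<And>i. i \<in> I \<Longrightarrow> f i = h i + (\<Sum>j\<in>I. M i j * f j)"
    and g: "\<And>i. i \<in> I \<Longrightarrow> g i = h i + (\<Sum>j\<in>I. M i j * g j)"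
    and i: "i \<in> I"
  shows "f i = g i"
proof -
  define u where "u i = f i - g i" for i
  have u: "(\<Sum>j\<in>I. M i j * u j) = u i" if "i \<in> I" for i
    using f[OF that] g[OF that] by (simp add: u_def right_diff_distrib sum_subtractf)
  have "dotc I (\<lambda>i. \<Sum>j\<in>I. M i j * u j) (\<lambda>i. \<Sum>j\<in>I. M i j * u j) = dotc I u u"
    by (rule dotc_cong) (simp_all add: u)
  with M[of u] have "Re (dotc I u u) \<le> q * Re (dotc I u u)" by simp
  then have "(1 - q) * Re (dotc I u u) \<le> 0" by (simp add: algebra_simps)
  then have "Re (dotc I u u) \<le> 0" using q by (auto simp: mult_le_0_iff)
  then have "Re (dotc I u u) = 0" using dotc_self_nonneg[of I u] by (rule antisym)
  from dotc_self_zero[OF I this i] show ?thesis by (simp add: u_def)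
qed

text \<open>\<open>1 - M\<close> is onto: a vector \<open>g\<close> orthogonal to all its columns satisfies \<open>\<langle>g, M g\<rangle> = \<langle>g, g\<rangle>\<close>, so
\<open>0 \<le> \<parallel>g - M g\<parallel>\<^sup>2 = \<parallel>M g\<parallel>\<^sup>2 - \<parallel>g\<parallel>\<^sup>2\<close>, which forces \<open>g = 0\<close>.\<close>

lemma strict_contraction_solvable:
  assumes I: "finite I" and q: "q < 1"
    and M: "\<And>f. Re (dotc I (\<lambda>i. \<Sum>j\<in>I. M i j * f j) (\<lambda>i. \<Sum>j\<in>I. M i j * f j)) \<le> q * Re (dotc I f f)"
  shows "\<exists>f. \<forall>i\<in>I. f i = h i + (\<Sum>j\<in>I. M i j * f j)"
proof -
  define X where "X j i = (if i = j then 1 else 0) - M i j" for j i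
  have X: "(\<Sum>j\<in>I. f j * X j i) = f i - (\<Sum>j\<in>I. M i j * f j)" if "i \<in> I" for f i
    using that I by (simp add: X_def right_diff_distrib sum_subtractf if_distrib[of "\<lambda>u. _ * u"] mult.commute cong: if_cong)
  obtain c where c: "\<forall>j\<in>I. dotc I (\<lambda>i. h i - (\<Sum>j\<in>I. c j * X j i)) (X j) = 0"
    using orthogonal_projection_exists[OF I I] by blast
  define g where "g i = h i - (\<Sum>j\<in>I. c j * X j i)" for i
  define m where "m i = (\<Sum>j\<in>I. M i j * g j)" for i
  have "dotc I g (\<lambda>i. \<Sum>j\<in>I. g j * X j i) = 0"
    unfolding dotc_lincomb_right g_def[abs_def] using c by simp
  moreover have "dotc I g (\<lambda>i. \<Sum>j\<in>I. g j * X j i) = dotc I g (\<lambda>i. g i - m i)"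
    by (rule dotc_cong) (auto simp: X m_def)
  ultimately have gm: "dotc I g m = dotc I g g" by (simp add: dotc_diff_right)
  have "0 \<le> Re (dotc I (\<lambda>i. g i - m i) (\<lambda>i. g i - m i))" by (rule dotc_self_nonneg)
  also have "\<dots> = Re (dotc I m m) - Re (dotc I g g)"
    using gm dotc_commute[of I m g] by (simp add: dotc_diff_left dotc_diff_right)
  also have "\<dots> \<le> (q - 1) * Re (dotc I g g)" using M[of g] by (simp add: m_def[abs_def] algebra_simps)
  finally have "Re (dotc I g g) = 0"
    using q dotc_self_nonneg[of I g] by (simp add: zero_le_mult_iff)
  then have "g i = 0" if "i \<in> I" for i using dotc_self_zero[OF I _ that] by simp
  then have "\<forall>i\<in>I. c i = h i + (\<Sum>j\<in>I. M i j * c j)" using X by (simp add: g_def)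
  then show ?thesis by blast
qed

lemma dotc_Plus:
  assumes "finite A" "finite B"
  shows "dotc (A <+> B) f g = dotc A (\<lambda>i. f (Inl i)) (\<lambda>i. g (Inl i)) + dotc B (\<lambda>i. f (Inr i)) (\<lambda>i. g (Inr i))"
  using assms by (simp add: dotc_def sum.Plus)

lemma dotc_tensor:
  "dotc (A \<times> B) (\<lambda>(i, j). f i * g j) (\<lambda>(i, j). f' i * g' j) = dotc A f f' * dotc B g g'"
  by (simp add: dotc_def sum_product sum.cartesian_product case_prod_unfold mult_ac)

section \<open>Interpolation by a lurking isometry\<close>

text \<open>The state space formula for the interpolant. Let \<open>q = \<langle>v, v\<rangle>\<close> be a finite-rank part of \<open>p\<close> with the
same values at the nodes, and factor the given matrix as \<open>L L*\<close>. Then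
\<open>1 + (v L)(v L)* = W W* + L L*\<close> at the nodes, where \<open>v L\<close> is a tensor product. So there is a
contraction \<open>V\<close> with \<open>V (1, v L) = (W, L)\<close>. At a general point \<open>x\<close> the second component of
\<open>V (1, v L) = (\<Phi>, L)\<close> is a linear equation for \<open>L\<close> with a unique solution because \<open>\<parallel>v x\<parallel> < 1\<close>,
and the first component then defines \<open>\<Phi>\<close>. By uniqueness \<open>\<Phi> = W\<close> at the nodes, and contractivity
of \<open>V\<close> says that \<open>1 - \<Phi> \<Phi>* - (1 - q) L L*\<close> is positive definite.\<close>

theorem pick_interpolation:
  fixes p :: "'a \<Rightarrow> 'a \<Rightarrow> complex" and z :: "nat \<Rightarrow> 'a" and n N :: nat
    and W :: "nat \<Rightarrow> nat \<Rightarrow> nat \<Rightarrow> complex"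
  assumes p: "pd UNIV p" and lt: "\<And>x. Re (p x x) < 1"
    and data: "pd ({..<n} \<times> {..<N}) (\<lambda>(i, a) (j, b).
       ((if a = b then 1 else 0) - (\<Sum>c<N. W i a c * cnj (W j b c))) / (1 - p (z i) (z j)))"
  shows "\<exists>\<Phi>. (\<forall>i<n. \<forall>a<N. \<forall>c<N. \<Phi> (z i) a c = W i a c) \<and>
     pd (UNIV \<times> {..<N}) (\<lambda>(x, a) (y, b).
       ((if a = b then 1 else 0) - (\<Sum>c<N. \<Phi> x a c * cnj (\<Phi> y b c))) / (1 - p x y))"
proof -
  obtain d :: nat and v where rest: "pd UNIV (\<lambda>x y. p x y - (\<Sum>\<alpha><d. v \<alpha> x * cnj (v \<alpha> y)))"
    and node: "\<forall>x\<in>UNIV. \<forall>t\<in>z ` {..<n}. p x t = (\<Sum>\<alpha><d. v \<alpha> x * cnj (v \<alpha> t))"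
    using pd_factor[OF p, of "z ` {..<n}"] by auto
  define vv where "vv x = (\<lambda>\<alpha>. v \<alpha> x)" for x
  define q where "q x y = dotc {..<d} (vv x) (vv y)" for x y
  have q: "q x y = (\<Sum>\<alpha><d. v \<alpha> x * cnj (v \<alpha> y))" for x y by (simp add: q_def dotc_def vv_def)
  have q_node: "q (z i) (z j) = p (z i) (z j)" if "j < n" for i j
    using node that by (auto simp: q)
  have pq: "pd UNIV (\<lambda>x y. p x y - q x y)" using rest by (simp add: q)
  have q_lt: "Re (q x x) < 1" for x
    using pd_diag_real(2)[OF pq, of x] lt[of x] by simp
  have p_ne: "1 - p x y \<noteq> 0" for x y
    using pd_norm_less_1[OF p, of x y] lt by auto
  define D where "D = (\<lambda>(i, a) (j, b).
     ((if a = b then 1 else 0) - (\<Sum>c<N. W i a c * cnj (W j b c))) / (1 - p (z i) (z j)))"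
  have "pd ({..<n} \<times> {..<N}) D" using data unfolding D_def .
  from pd_factor[OF this finite_cartesian_product[OF finite_lessThan finite_lessThan] subset_refl] obtain r :: nat and \<eta>
    where "\<forall>s\<in>{..<n} \<times> {..<N}. \<forall>t\<in>{..<n} \<times> {..<N}. D s t = (\<Sum>\<rho><r. \<eta> \<rho> s * cnj (\<eta> \<rho> t))"
    by blast
  then have gram: "D s t = (\<Sum>\<rho><r. \<eta> \<rho> s * cnj (\<eta> \<rho> t))"
    if "s \<in> {..<n} \<times> {..<N}" "t \<in> {..<n} \<times> {..<N}" for s t using that by blast
  define L0 where "L0 i a = (\<lambda>\<rho>. \<eta> \<rho> (i, a))" for i :: nat and a :: nat
  define I where "I = {..<N} <+> ({..<d} \<times> {..<r})"
  define R where "R = {..<N} <+> {..<r}"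
  have fin: "finite I" "finite R" by (auto simp: I_def R_def)
  \<comment> \<open>\<open>XX b u l\<close> is the vector \<open>(e\<^sub>b, u \<otimes> l)\<close> and \<open>YY w l\<close> is \<open>(w, l)\<close>.\<close>
  define XX :: "nat \<Rightarrow> (nat \<Rightarrow> complex) \<Rightarrow> (nat \<Rightarrow> complex) \<Rightarrow> nat + nat \<times> nat \<Rightarrow> complex"
    where "XX b u l = case_sum (\<lambda>c. if c = b then 1 else 0) (\<lambda>(\<alpha>, \<rho>). u \<alpha> * l \<rho>)" for b u l
  define YY :: "(nat \<Rightarrow> complex) \<Rightarrow> (nat \<Rightarrow> complex) \<Rightarrow> nat + nat \<Rightarrow> complex"
    where "YY w l = case_sum w l" for w l
  have dX: "dotc I (XX a u l) (XX b u' l') = (if a = b then 1 else 0) + dotc {..<d} u u' * dotc {..<r} l l'"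
    if "a < N" for a b u u' l l'
  proof -
    have "dotc {..<N} (\<lambda>c. if c = a then 1 else 0) (\<lambda>c. if c = b then 1 else 0) = (if a = b then 1 else 0)"
      using that by (simp add: dotc_def if_distrib[of "\<lambda>u. u * _"] cong: if_cong)
    then show ?thesis
      by (simp add: I_def dotc_Plus XX_def dotc_tensor[unfolded case_prod_unfold] case_prod_unfold)
  qed
  have dY: "dotc R (YY w l) (YY w' l') = dotc {..<N} w w' + dotc {..<r} l l'" for w w' l l'
    by (simp add: R_def dotc_Plus YY_def)
  define XW where "XW = (\<lambda>(j, b). XX b (vv (z j)) (L0 j b))"
  define YW where "YW = (\<lambda>(j, b). YY (W j b) (L0 j b))"
  have gramW: "dotc I (XW s) (XW t) = dotc R (YW s) (YW t)"
    if s: "s \<in> {..<n} \<times> {..<N}" and t: "t \<in> {..<n} \<times> {..<N}" for s t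
  proof -
    obtain i a j b where st: "s = (i, a)" "t = (j, b)" by (metis surj_pair)
    have ia: "i < n" "a < N" "j < n" "b < N" using s t st by auto
    have "((if a = b then 1 else 0) - dotc {..<N} (W i a) (W j b)) / (1 - p (z i) (z j)) = dotc {..<r} (L0 i a) (L0 j b)"
      using gram[OF s t] by (simp add: st D_def dotc_def L0_def)
    then have "(if a = b then 1 else 0) - dotc {..<N} (W i a) (W j b) = (1 - p (z i) (z j)) * dotc {..<r} (L0 i a) (L0 j b)"
      using p_ne[of "z i" "z j"] by (simp add: divide_eq_eq mult.commute)
    then show ?thesis using ia
      by (simp add: st XW_def YW_def dX dY q_node flip: q_def) (auto simp: algebra_simps split: if_splits)
  qed
  have "finite ({..<n} \<times> {..<N})" by simp
  from contraction_of_equal_gram[OF fin this gramW] obtain V where V': "contraction_on I R V \<and>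
      (\<forall>t\<in>{..<n} \<times> {..<N}. \<forall>k\<in>R. (\<Sum>i\<in>I. V k i * XW t i) = YW t k)" ..
  note V = conjunct1[OF V'] and VW = conjunct2[OF V', rule_format]
  have V0: "(\<Sum>i\<in>I. V k i * XX b (vv (z j)) (L0 j b) i) = YY (W j b) (L0 j b) k"
    if "j < n" "b < N" "k \<in> R" for j b k
    using VW[of "(j, b)" k] that by (simp add: XW_def YW_def)
  \<comment> \<open>\<open>M x\<close> is the map \<open>l \<mapsto> V (0, v x \<otimes> l)\<close> followed by the projection to the second component.\<close>
  define M where "M x \<rho> \<sigma> = (\<Sum>\<alpha><d. V (Inr \<rho>) (Inr (\<alpha>, \<sigma>)) * vv x \<alpha>)" for x \<rho> \<sigma>
  have Minr: "(\<Sum>\<sigma><r. M x \<rho> \<sigma> * l \<sigma>) = (\<Sum>i\<in>I. V (Inr \<rho>) i * case_sum (\<lambda>_. 0) (\<lambda>(\<alpha>, \<rho>). vv x \<alpha> * l \<rho>) i)" for x \<rho> l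
  proof -
    have "(\<Sum>i\<in>I. V (Inr \<rho>) i * case_sum (\<lambda>_. 0) (\<lambda>(\<alpha>, \<rho>). vv x \<alpha> * l \<rho>) i)
       = (\<Sum>(\<alpha>,\<sigma>)\<in>{..<d} \<times> {..<r}. V (Inr \<rho>) (Inr (\<alpha>, \<sigma>)) * (vv x \<alpha> * l \<sigma>))"
      by (simp add: I_def sum.Plus case_prod_unfold)
    also have "\<dots> = (\<Sum>\<sigma><r. \<Sum>\<alpha><d. V (Inr \<rho>) (Inr (\<alpha>, \<sigma>)) * (vv x \<alpha> * l \<sigma>))"
      by (subst sum.swap) (simp add: sum.cartesian_product)
    finally show ?thesis by (simp add: M_def sum_distrib_right mult.assoc)
  qed
  have Xsplit: "(\<Sum>i\<in>I. V (Inr \<rho>) i * XX b (vv x) l i) = V (Inr \<rho>) (Inl b) + (\<Sum>\<sigma><r. M x \<rho> \<sigma> * l \<sigma>)"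
    if "b < N" for b x l \<rho>
    unfolding Minr using that
    by (simp add: I_def sum.Plus XX_def if_distrib[of "\<lambda>u. _ * u"] cong: if_cong)
  have Mle: "Re (dotc {..<r} (\<lambda>\<rho>. \<Sum>\<sigma><r. M x \<rho> \<sigma> * l \<sigma>) (\<lambda>\<rho>. \<Sum>\<sigma><r. M x \<rho> \<sigma> * l \<sigma>))
      \<le> Re (q x x) * Re (dotc {..<r} l l)" for x l
  proof -
    define f :: "nat + nat \<times> nat \<Rightarrow> complex" where "f = case_sum (\<lambda>_. 0) (\<lambda>(\<alpha>, \<rho>). vv x \<alpha> * l \<rho>)"
    define g where "g k = (\<Sum>i\<in>I. V k i * f i)" for k
    have "Re (dotc {..<r} (\<lambda>\<rho>. g (Inr \<rho>)) (\<lambda>\<rho>. g (Inr \<rho>))) \<le> Re (dotc R g g)"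
      using dotc_self_nonneg[of "{..<N}" "\<lambda>i. g (Inl i)"] by (simp add: R_def dotc_Plus)
    also have "\<dots> \<le> Re (dotc I f f)" using V by (simp add: contraction_on_def g_def[abs_def])
    also have "dotc I f f = q x x * dotc {..<r} l l"
      by (simp add: I_def dotc_Plus f_def dotc_tensor[unfolded case_prod_unfold] case_prod_unfold q_def)
        (simp add: dotc_def)
    also have "Re \<dots> = Re (q x x) * Re (dotc {..<r} l l)"
      by (simp add: q_def dotc_self)
    finally show ?thesis unfolding Minr g_def f_def .
  qed
  have "\<forall>s. \<exists>l. \<forall>\<rho>\<in>{..<r}. l \<rho> = V (Inr \<rho>) (Inl (snd s)) + (\<Sum>\<sigma><r. M (fst s) \<rho> \<sigma> * l \<sigma>)"
    by (intro allI strict_contraction_solvable[OF _ q_lt Mle]) simp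
  from choice[OF this] obtain L' where
    L': "\<forall>s. \<forall>\<rho>\<in>{..<r}. L' s \<rho> = V (Inr \<rho>) (Inl (snd s)) + (\<Sum>\<sigma><r. M (fst s) \<rho> \<sigma> * L' s \<sigma>)" ..
  define L where "L x b = L' (x, b)" for x b
  have L: "L x b \<rho> = V (Inr \<rho>) (Inl b) + (\<Sum>\<sigma><r. M x \<rho> \<sigma> * L x b \<sigma>)" if "\<rho> < r" for x b \<rho>
    using bspec[OF spec[OF L', of "(x, b)"], of \<rho>] that unfolding L_def by simp
  define \<Phi> where "\<Phi> x b c = (\<Sum>i\<in>I. V (Inl c) i * XX b (vv x) (L x b) i)" for x b c
  have L_node: "L (z j) b \<rho> = L0 j b \<rho>" if "j < n" "b < N" "\<rho> < r" for j b \<rho>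
  proof (rule strict_contraction_unique[OF finite_lessThan q_lt[of "z j"] Mle])
    show "\<rho> \<in> {..<r}" using that by simp
    show "L (z j) b \<sigma> = V (Inr \<sigma>) (Inl b) + (\<Sum>\<tau><r. M (z j) \<sigma> \<tau> * L (z j) b \<tau>)" if "\<sigma> \<in> {..<r}" for \<sigma>
      by (rule L) (use that in simp)
    show "L0 j b \<sigma> = V (Inr \<sigma>) (Inl b) + (\<Sum>\<tau><r. M (z j) \<sigma> \<tau> * L0 j b \<tau>)" if "\<sigma> \<in> {..<r}" for \<sigma>
      using V0[OF \<open>j < n\<close> \<open>b < N\<close>, of "Inr \<sigma>"] that Xsplit[OF \<open>b < N\<close>] by (simp add: R_def YY_def InrI)
  qed
  have \<Phi>_node: "\<Phi> (z j) b c = W j b c" if "j < n" "b < N" "c < N" for j b c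
  proof -
    have "\<Phi> (z j) b c = (\<Sum>i\<in>I. V (Inl c) i * XX b (vv (z j)) (L0 j b) i)"
      unfolding \<Phi>_def
      by (rule sum.cong[OF refl]) (use that L_node in \<open>auto simp: I_def XX_def\<close>)
    then show ?thesis using V0[of j b "Inl c"] that by (simp add: R_def YY_def InlI)
  qed
  define X where "X = (\<lambda>(x, a). XX a (vv x) (L x a))"
  define Y where "Y = (\<lambda>(x, a). YY (\<Phi> x a) (L x a))"
  have "pd (UNIV \<times> {..<N}) (\<lambda>s t. dotc I (X s) (X t) - dotc R (Y s) (Y t))"
  proof (rule pd_gram_contraction[OF V])
    fix s k assume s: "s \<in> (UNIV :: 'a set) \<times> {..<N}" and k: "k \<in> R"
    obtain x a where xa: "s = (x, a)" by (metis surj_pair)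
    have "L x a \<rho> = (\<Sum>i\<in>I. V (Inr \<rho>) i * XX a (vv x) (L x a) i)" if "\<rho> < r" for \<rho>
      using s xa Xsplit[of a \<rho> x "L x a"] L[OF that, of x a] by simp
    then show "Y s k = (\<Sum>i\<in>I. V k i * X s i)"
      using k unfolding R_def xa X_def Y_def YY_def \<Phi>_def by (elim PlusE) simp_all
  qed
  then have \<Delta>: "pd (UNIV \<times> {..<N}) (\<lambda>s t. (1 / (1 - p (fst s) (fst t))) * (dotc I (X s) (X t) - dotc R (Y s) (Y t)))"
    by (intro pd_mult pd_pullback[OF pd_inverse_one_minus[OF p lt]]) auto
  have "pd UNIV (\<lambda>x y. 1 + (1 / (1 - p x y)) * (p x y - q x y))"
    by (intro pd_add pd_const pd_mult pd_inverse_one_minus[OF p lt] pq)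
  from pd_pullback[OF this, of fst "UNIV \<times> {..<N}"]
  \<comment> \<open>The factor in front of \<open>L L*\<close> is \<open>(1 - q) / (1 - p)\<close>, which brings the result back from \<open>q\<close> to \<open>p\<close>.\<close>
  have LL: "pd (UNIV \<times> {..<N}) (\<lambda>s t. (1 + (1 / (1 - p (fst s) (fst t))) * (p (fst s) (fst t) - q (fst s) (fst t)))
      * (\<Sum>\<rho><r. L (fst s) (snd s) \<rho> * cnj (L (fst t) (snd t) \<rho>)))"
    by (intro pd_mult pd_sum pd_rank_one) auto
  have "pd (UNIV \<times> {..<N}) (\<lambda>(x, a) (y, b).
       ((if a = b then 1 else 0) - (\<Sum>c<N. \<Phi> x a c * cnj (\<Phi> y b c))) / (1 - p x y))"
  proof (rule pd_cong[OF pd_add[OF \<Delta> LL]])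
    fix s t assume s: "s \<in> (UNIV :: 'a set) \<times> {..<N}" and t: "t \<in> (UNIV :: 'a set) \<times> {..<N}"
    obtain x a y b where st: "s = (x, a)" "t = (y, b)" by (metis surj_pair)
    define \<delta> :: complex where "\<delta> = (if a = b then 1 else 0)"
    define l where "l = dotc {..<r} (L x a) (L y b)"
    define w where "w = dotc {..<N} (\<Phi> x a) (\<Phi> y b)"
    have ab: "a < N" "b < N" using s t st by auto
    have 1: "dotc I (X s) (X t) - dotc R (Y s) (Y t) = \<delta> + q x y * l - (w + l)"
      using ab by (simp add: st X_def Y_def dX dY q_def \<delta>_def l_def w_def)
    have 2: "(\<Sum>\<rho><r. L (fst s) (snd s) \<rho> * cnj (L (fst t) (snd t) \<rho>)) = l"
      by (simp add: st l_def dotc_def)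
    have 3: "(\<lambda>(x, a) (y, b). ((if a = b then 1 else 0) - (\<Sum>c<N. \<Phi> x a c * cnj (\<Phi> y b c))) / (1 - p x y)) s t
       = (\<delta> - w) / (1 - p x y)"
      by (simp add: st \<delta>_def w_def dotc_def)
    show "(\<lambda>(x, a) (y, b). ((if a = b then 1 else 0) - (\<Sum>c<N. \<Phi> x a c * cnj (\<Phi> y b c))) / (1 - p x y)) s t
      = 1 / (1 - p (fst s) (fst t)) * (dotc I (X s) (X t) - dotc R (Y s) (Y t)) +
        (1 + 1 / (1 - p (fst s) (fst t)) * (p (fst s) (fst t) - q (fst s) (fst t))) *
         (\<Sum>\<rho><r. L (fst s) (snd s) \<rho> * cnj (L (fst t) (snd t) \<rho>))"
      unfolding 1 2 3 using p_ne[of x y] by (simp add: st divide_simps) (simp add: algebra_simps)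
  qed
  with \<Phi>_node show ?thesis by blast
qed

section \<open>The reproducing kernel Hilbert space of a kernel\<close>

definition energy :: "('a \<Rightarrow> 'a \<Rightarrow> complex) \<Rightarrow> 'a set \<Rightarrow> ('a \<Rightarrow> complex) \<Rightarrow> real" where
  "energy k F c = Re (\<Sum>x\<in>F. \<Sum>y\<in>F. cnj (c x) * k x y * c y)"

text \<open>For \<open>C \<ge> 0\<close> this is positivity of \<open>C\<^sup>2 k - f f*\<close>: the functional
\<open>\<Sum>x. c x * k\<^sub>x \<mapsto> \<Sum>x. c x * cnj (f x)\<close> on the span of the columns of \<open>k\<close> is well defined and has norm at most \<open>C\<close>.
So the functions bounded in this sense represent the dual of the span, which is the Hilbert space with
kernel \<open>k\<close>; no completion has to be formed.\<close>

definition bounded_by :: "('a \<Rightarrow> 'a \<Rightarrow> complex) \<Rightarrow> real \<Rightarrow> ('a \<Rightarrow> complex) \<Rightarrow> bool" where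
  "bounded_by k C f \<longleftrightarrow> (\<forall>F c. finite F \<longrightarrow> norm (\<Sum>x\<in>F. cnj (c x) * f x) \<le> C * sqrt (energy k F c))"

definition rkhs_space :: "('a \<Rightarrow> 'a \<Rightarrow> complex) \<Rightarrow> ('a \<Rightarrow> complex) set" where
  "rkhs_space k = {f. \<exists>C. bounded_by k C f}"

definition interpolating_coeffs :: "('a \<Rightarrow> 'a \<Rightarrow> complex) \<Rightarrow> 'a set \<Rightarrow> ('a \<Rightarrow> complex) \<Rightarrow> 'a \<Rightarrow> complex" where
  "interpolating_coeffs k F f = (SOME c. \<forall>x\<in>F. (\<Sum>y\<in>F. k x y * c y) = f x)"

text \<open>The inner product of the functions in the span of the columns \<open>k\<^sub>x\<close> with \<open>x \<in> F\<close> that agree with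
\<open>f\<close> and \<open>g\<close> on \<open>F\<close>. These are the orthogonal projections of \<open>f\<close> and \<open>g\<close>, so their norms increase
with \<open>F\<close>, and the inner product of \<open>f\<close> and \<open>g\<close> is the limit over all finite sets.\<close>

definition section_ip :: "('a \<Rightarrow> 'a \<Rightarrow> complex) \<Rightarrow> 'a set \<Rightarrow> ('a \<Rightarrow> complex) \<Rightarrow> ('a \<Rightarrow> complex) \<Rightarrow> complex" where
  "section_ip k F f g = (\<Sum>x\<in>F. cnj (interpolating_coeffs k F g x) * f x)"

definition rkhs_ip :: "('a \<Rightarrow> 'a \<Rightarrow> complex) \<Rightarrow> ('a \<Rightarrow> complex) \<Rightarrow> ('a \<Rightarrow> complex) \<Rightarrow> complex" where
  "rkhs_ip k f g = Lim finite_sets_at_top (\<lambda>F. section_ip k F f g)"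

lemma tendsto_of_mono_bounded:
  fixes a :: "'a set \<Rightarrow> real"
  assumes mono: "\<And>F G. finite G \<Longrightarrow> F \<subseteq> G \<Longrightarrow> a F \<le> a G"
    and bdd: "\<And>F. finite F \<Longrightarrow> a F \<le> B"
  shows "(a \<longlongrightarrow> (SUP F\<in>{F. finite F}. a F)) finite_sets_at_top"
proof -
  have bd: "bdd_above (a ` {F. finite F})" unfolding bdd_above_def using bdd by auto
  show ?thesis
  proof (rule order_tendstoI)
    fix b assume "b < (SUP F\<in>{F. finite F}. a F)"
    then obtain F where F: "finite F" "b < a F"
      by (subst (asm) less_cSUP_iff[OF _ bd]) auto
    show "\<forall>\<^sub>F G in finite_sets_at_top. b < a G"
      unfolding eventually_finite_subsets_at_top
      by (rule exI[of _ F]) (use F mono in \<open>auto intro: less_le_trans\<close>)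
  next
    fix b assume b: "(SUP F\<in>{F. finite F}. a F) < b"
    have "a F < b" if "finite F" for F
      using cSUP_upper[OF _ bd, of F] that b by simp
    then show "\<forall>\<^sub>F G in finite_sets_at_top. a G < b"
      by (intro eventually_finite_subsets_at_top_weakI) auto
  qed
qed

context
  fixes k :: "'a \<Rightarrow> 'a \<Rightarrow> complex"
  assumes k: "pd UNIV k"
begin

lemma energy_nonneg: "finite F \<Longrightarrow> 0 \<le> energy k F c"
  using pdD[OF k, of F c] by (simp add: energy_def less_eq_complex_def)

lemma energy_eq: "finite F \<Longrightarrow> of_real (energy k F c) = (\<Sum>x\<in>F. \<Sum>y\<in>F. cnj (c x) * k x y * c y)"
  using pdD[OF k, of F c] by (simp add: energy_def less_eq_complex_def complex_eq_iff)

lemma kernel_cnj: "cnj (k x y) = k y x"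
  using pd_hermitian[OF k, of x y] by simp

lemma bounded_byD: "bounded_by k C f \<Longrightarrow> finite F \<Longrightarrow> norm (\<Sum>x\<in>F. cnj (c x) * f x) \<le> C * sqrt (energy k F c)"
  by (simp add: bounded_by_def)

lemma bounded_by_add:
  assumes "bounded_by k C f" "bounded_by k D g"
  shows "bounded_by k (C + D) (\<lambda>x. f x + g x)"
  unfolding bounded_by_def
proof (intro allI impI)
  fix F c assume F: "finite (F :: 'a set)"
  have "norm (\<Sum>x\<in>F. cnj (c x) * (f x + g x)) \<le> norm (\<Sum>x\<in>F. cnj (c x) * f x) + norm (\<Sum>x\<in>F. cnj (c x) * g x)"
    by (simp add: distrib_left sum.distrib norm_triangle_ineq)
  also have "\<dots> \<le> C * sqrt (energy k F c) + D * sqrt (energy k F c)"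
    by (intro add_mono bounded_byD assms F)
  finally show "norm (\<Sum>x\<in>F. cnj (c x) * (f x + g x)) \<le> (C + D) * sqrt (energy k F c)"
    by (simp add: distrib_right)
qed

lemma bounded_by_scale:
  assumes "bounded_by k C f"
  shows "bounded_by k (norm a * C) (\<lambda>x. a * f x)"
  unfolding bounded_by_def
proof (intro allI impI)
  fix F c assume F: "finite (F :: 'a set)"
  have "norm (\<Sum>x\<in>F. cnj (c x) * (a * f x)) = norm a * norm (\<Sum>x\<in>F. cnj (c x) * f x)"
    by (simp add: mult.left_commute norm_mult flip: sum_distrib_left)
  also have "\<dots> \<le> norm a * (C * sqrt (energy k F c))"
    by (intro mult_left_mono bounded_byD assms F) simp
  finally show "norm (\<Sum>x\<in>F. cnj (c x) * (a * f x)) \<le> norm a * C * sqrt (energy k F c)"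
    by (simp add: mult.assoc)
qed

lemma bounded_by_kernel: "bounded_by k (sqrt (Re (k y y))) (\<lambda>x. k x y)"
  unfolding bounded_by_def
proof (intro allI impI)
  fix F c assume F: "finite (F :: 'a set)"
  define u where "u = (\<Sum>x\<in>F. cnj (c x) * k x y)"
  have kyy: "k y y = of_real (Re (k y y))" "0 \<le> Re (k y y)" using pd_diag_real[OF k, of y] by auto
  have u': "(\<Sum>x\<in>F. k y x * c x) = cnj u"
    by (simp add: u_def kernel_cnj mult.commute)
  have "0 \<le> (\<Sum>x\<in>F. \<Sum>x'\<in>F. cnj (c x) * (k x x' - k x y * k y x' / k y y) * c x')"
    by (rule pdD[OF pd_schur_complement[OF k] F]) auto
  also have "\<dots> = (\<Sum>x\<in>F. \<Sum>x'\<in>F. cnj (c x) * k x x' * c x') - (\<Sum>x\<in>F. \<Sum>x'\<in>F. (cnj (c x) * k x y) * (k y x' * c x') / k y y)"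
    by (simp add: right_diff_distrib left_diff_distrib sum_subtractf mult.assoc)
  also have "(\<Sum>x\<in>F. \<Sum>x'\<in>F. (cnj (c x) * k x y) * (k y x' * c x') / k y y) = u * cnj u / k y y"
    unfolding u'[symmetric] unfolding u_def sum_product sum_divide_distrib ..
  also have "u * cnj u / k y y = of_real ((norm u)\<^sup>2 / Re (k y y))"
    by (subst kyy(1)) (simp add: complex_norm_square del: of_real_power)
  also have "(\<Sum>x\<in>F. \<Sum>x'\<in>F. cnj (c x) * k x x' * c x') = of_real (energy k F c)"
    by (simp add: energy_eq F)
  finally have *: "(norm u)\<^sup>2 / Re (k y y) \<le> energy k F c"
    by (simp add: less_eq_complex_def)
  have "(norm u)\<^sup>2 \<le> Re (k y y) * energy k F c"
  proof (cases "Re (k y y) = 0")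
    case True
    then have "k y y = 0" using kyy by simp
    then have "u = 0" unfolding u_def using pd_zero_diag[OF k] by simp
    then show ?thesis using True by simp
  next
    case False
    then show ?thesis using * kyy(2) by (simp add: field_simps)
  qed
  then have "norm u \<le> sqrt (Re (k y y) * energy k F c)" by (rule real_le_rsqrt)
  then show "norm (\<Sum>x\<in>F. cnj (c x) * k x y) \<le> sqrt (Re (k y y)) * sqrt (energy k F c)"
    by (simp add: u_def real_sqrt_mult)
qed

lemma rkhs_space_add: "f \<in> rkhs_space k \<Longrightarrow> g \<in> rkhs_space k \<Longrightarrow> (\<lambda>x. f x + g x) \<in> rkhs_space k"
  unfolding rkhs_space_def using bounded_by_add by blast

lemma rkhs_space_scale: "f \<in> rkhs_space k \<Longrightarrow> (\<lambda>x. a * f x) \<in> rkhs_space k"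
  unfolding rkhs_space_def using bounded_by_scale by blast

lemma rkhs_space_zero: "(\<lambda>x. 0) \<in> rkhs_space k"
  unfolding rkhs_space_def bounded_by_def by (auto intro!: exI[of _ 0])

lemma rkhs_space_kernel: "(\<lambda>x. k x y) \<in> rkhs_space k"
  unfolding rkhs_space_def using bounded_by_kernel by blast

text \<open>The values of \<open>f\<close> on \<open>F\<close> lie in the range of the Gram matrix: the component \<open>g\<close> orthogonal to the
range has energy \<open>0\<close>, so boundedness of \<open>f\<close> makes \<open>f\<close> orthogonal to \<open>g\<close>.\<close>

lemma interpolating_coeffs:
  assumes f: "f \<in> rkhs_space k" and F: "finite F" and x: "x \<in> F"
  shows "(\<Sum>y\<in>F. k x y * interpolating_coeffs k F f y) = f x"
proof -
  obtain C where C: "bounded_by k C f" using f by (auto simp: rkhs_space_def)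
  obtain c where c: "\<forall>y\<in>F. dotc F (\<lambda>x. f x - (\<Sum>y\<in>F. c y * k x y)) (\<lambda>x. k x y) = 0"
    using orthogonal_projection_exists[OF F F, of f "\<lambda>y x. k x y"] by auto
  define g where "g x = f x - (\<Sum>y\<in>F. c y * k x y)" for x
  have g0: "(\<Sum>x\<in>F. k y x * g x) = 0" if "y \<in> F" for y
    using c that by (simp add: g_def dotc_def kernel_cnj mult.commute)
  have "(\<Sum>x\<in>F. \<Sum>y\<in>F. cnj (g x) * k x y * g y) = 0"
    by (simp add: g0 mult.assoc flip: sum_distrib_left)
  then have "energy k F g = 0" by (simp add: energy_def)
  then have gf: "(\<Sum>x\<in>F. cnj (g x) * f x) = 0" using bounded_byD[OF C F, of g] by simp
  have "(\<Sum>x\<in>F. cnj (g x) * (\<Sum>y\<in>F. c y * k x y)) = (\<Sum>y\<in>F. c y * cnj (\<Sum>x\<in>F. k y x * g x))"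
    unfolding sum_distrib_left cnj_sum by (subst sum.swap) (simp add: kernel_cnj mult_ac)
  also have "\<dots> = 0" by (simp add: g0 del: cnj_sum)
  finally have "(\<Sum>x\<in>F. cnj (g x) * g x) = 0"
    using gf by (simp add: g_def right_diff_distrib sum_subtractf)
  then have "Re (dotc F g g) = 0" by (simp add: dotc_def mult.commute)
  then have "g x = 0" if "x \<in> F" for x using dotc_self_zero[OF F _ that] by blast
  then have "\<forall>x\<in>F. (\<Sum>y\<in>F. k x y * c y) = f x" by (simp add: g_def mult.commute)
  then have "\<forall>x\<in>F. (\<Sum>y\<in>F. k x y * interpolating_coeffs k F f y) = f x"
    unfolding interpolating_coeffs_def by (rule someI[where P = "\<lambda>c. \<forall>x\<in>F. (\<Sum>y\<in>F. k x y * c y) = f x"])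
  then show ?thesis using x by blast
qed

text \<open>The Gram matrix may be singular; this lemma shows that the choice of coefficients does not matter.\<close>

lemma section_ip_eq:
  assumes f: "f \<in> rkhs_space k" and F: "finite F"
    and c: "\<And>x. x \<in> F \<Longrightarrow> (\<Sum>y\<in>F. k x y * c y) = g x" and g: "g \<in> rkhs_space k"
  shows "section_ip k F f g = (\<Sum>x\<in>F. cnj (c x) * f x)"
proof -
  have *: "(\<Sum>x\<in>F. cnj (d x) * f x) = (\<Sum>y\<in>F. interpolating_coeffs k F f y * cnj (g y))"
    if d: "\<And>x. x \<in> F \<Longrightarrow> (\<Sum>y\<in>F. k x y * d y) = g x" for d
  proof -
    have "(\<Sum>x\<in>F. cnj (d x) * f x) = (\<Sum>x\<in>F. cnj (d x) * (\<Sum>y\<in>F. k x y * interpolating_coeffs k F f y))"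
      using interpolating_coeffs[OF f F] by simp
    also have "\<dots> = (\<Sum>y\<in>F. interpolating_coeffs k F f y * cnj (\<Sum>x\<in>F. k y x * d x))"
      unfolding sum_distrib_left cnj_sum by (subst sum.swap) (simp add: kernel_cnj mult_ac)
    also have "\<dots> = (\<Sum>y\<in>F. interpolating_coeffs k F f y * cnj (g y))"
      using d by (simp del: cnj_sum)
    finally show ?thesis .
  qed
  show ?thesis unfolding section_ip_def
    using *[of c] *[of "interpolating_coeffs k F g"] c interpolating_coeffs[OF g F] by simp
qed

lemma section_ip_add:
  "section_ip k F (\<lambda>x. f x + g x) h = section_ip k F f h + section_ip k F g h"
  by (simp add: section_ip_def distrib_left sum.distrib)

lemma section_ip_scale: "section_ip k F (\<lambda>x. a * f x) h = a * section_ip k F f h"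
  by (simp add: section_ip_def mult.left_commute sum_distrib_left)

lemma section_ip_sym:
  assumes f: "f \<in> rkhs_space k" and g: "g \<in> rkhs_space k" and F: "finite F"
  shows "section_ip k F g f = cnj (section_ip k F f g)"
proof -
  have "section_ip k F g f = (\<Sum>x\<in>F. cnj (interpolating_coeffs k F f x) * (\<Sum>y\<in>F. k x y * interpolating_coeffs k F g y))"
    using interpolating_coeffs[OF g F] by (simp add: section_ip_def)
  also have "\<dots> = (\<Sum>y\<in>F. interpolating_coeffs k F g y * cnj (\<Sum>x\<in>F. k y x * interpolating_coeffs k F f x))"
    unfolding sum_distrib_left cnj_sum by (subst sum.swap) (simp add: kernel_cnj mult_ac)
  also have "\<dots> = (\<Sum>y\<in>F. interpolating_coeffs k F g y * cnj (f y))"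
    using interpolating_coeffs[OF f F] by (simp del: cnj_sum)
  also have "\<dots> = cnj (section_ip k F f g)" by (simp add: section_ip_def)
  finally show ?thesis .
qed

lemma section_ip_self:
  assumes f: "f \<in> rkhs_space k" and F: "finite F"
  shows "section_ip k F f f = of_real (energy k F (interpolating_coeffs k F f))"
  using interpolating_coeffs[OF f F]
  by (simp add: section_ip_def energy_eq[OF F] mult.assoc flip: sum_distrib_left)

text \<open>The difference of the two sides is the energy of the difference of the two coefficient vectors.\<close>

lemma section_ip_mono:
  assumes f: "f \<in> rkhs_space k" and G: "finite G" and FG: "F \<subseteq> G"
  shows "Re (section_ip k F f f) \<le> Re (section_ip k G f f)"
proof -
  have F: "finite F" using finite_subset[OF FG G] .
  define c where "c = interpolating_coeffs k F f"
  define d where "d = interpolating_coeffs k G f"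
  define e where "e x = (if x \<in> F then c x else 0)" for x
  have d: "(\<Sum>y\<in>G. k x y * d y) = f x" if "x \<in> G" for x
    using interpolating_coeffs[OF f G that] by (simp add: d_def)
  have d': "(\<Sum>x\<in>G. cnj (d x) * k x y) = cnj (f y)" if "y \<in> G" for y
    by (simp add: d[OF that, symmetric] kernel_cnj mult.commute)
  have ee: "(\<Sum>x\<in>G. \<Sum>y\<in>G. cnj (e x) * k x y * e y) = section_ip k F f f"
    using form_extend[OF G FG, of c k] section_ip_self[OF f F]
    by (simp add: e_def[abs_def] c_def energy_eq[OF F])
  have ef: "(\<Sum>x\<in>G. cnj (e x) * f x) = section_ip k F f f"
    unfolding section_ip_def c_def[symmetric]
    by (rule sum.mono_neutral_cong_right) (use G FG in \<open>auto simp: e_def\<close>)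
  have ed: "(\<Sum>x\<in>G. \<Sum>y\<in>G. cnj (e x) * k x y * d y) = section_ip k F f f"
    by (simp add: mult.assoc d ef flip: sum_distrib_left)
  have de: "(\<Sum>x\<in>G. \<Sum>y\<in>G. cnj (d x) * k x y * e y) = cnj (section_ip k F f f)"
  proof -
    have "(\<Sum>x\<in>G. \<Sum>y\<in>G. cnj (d x) * k x y * e y) = (\<Sum>y\<in>G. (\<Sum>x\<in>G. cnj (d x) * k x y) * e y)"
      by (subst sum.swap) (simp add: sum_distrib_right)
    also have "\<dots> = (\<Sum>y\<in>G. cnj (f y) * e y)" by (simp add: d')
    finally show ?thesis by (simp add: ef[symmetric] mult.commute)
  qed
  have dd: "(\<Sum>x\<in>G. \<Sum>y\<in>G. cnj (d x) * k x y * d y) = section_ip k G f f"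
    by (simp add: section_ip_self[OF f G] d_def energy_eq[OF G])
  have "0 \<le> (\<Sum>x\<in>G. \<Sum>y\<in>G. cnj (d x - e x) * k x y * (d y - e y))"
    by (rule pdD[OF k G]) simp
  also have "\<dots> = (\<Sum>x\<in>G. \<Sum>y\<in>G. cnj (d x) * k x y * d y) - (\<Sum>x\<in>G. \<Sum>y\<in>G. cnj (d x) * k x y * e y)
      - (\<Sum>x\<in>G. \<Sum>y\<in>G. cnj (e x) * k x y * d y) + (\<Sum>x\<in>G. \<Sum>y\<in>G. cnj (e x) * k x y * e y)"
    by (simp add: algebra_simps sum_subtractf sum.distrib)
  also have "\<dots> = section_ip k G f f - cnj (section_ip k F f f)"
    unfolding dd de ed ee by simp
  finally show ?thesis by (simp add: less_eq_complex_def)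
qed

text \<open>Applying the bound to the interpolating coefficients gives \<open>T \<le> C * sqrt T\<close>, where \<open>T\<close> is the left-hand
side of the conclusion. Families occur because elements of \<open>H \<otimes> \<complex>\<^sup>N\<close> have \<open>N\<close> components.\<close>

lemma section_ip_family_bound:
  assumes C: "0 \<le> C" and A: "finite A" and F: "finite F"
    and g: "\<And>a. a \<in> A \<Longrightarrow> g a \<in> rkhs_space k"
    and bd: "\<And>c. norm (\<Sum>a\<in>A. \<Sum>x\<in>F. cnj (c a x) * g a x) \<le> C * sqrt (\<Sum>a\<in>A. energy k F (c a))"
  shows "(\<Sum>a\<in>A. Re (section_ip k F (g a) (g a))) \<le> C\<^sup>2"
proof -
  define c where "c a = interpolating_coeffs k F (g a)" for a
  define T where "T = (\<Sum>a\<in>A. energy k F (c a))"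
  have T: "0 \<le> T" unfolding T_def by (intro sum_nonneg energy_nonneg F)
  have ip: "section_ip k F (g a) (g a) = of_real (energy k F (c a))" if "a \<in> A" for a
    using section_ip_self[OF g[OF that] F] by (simp add: c_def)
  have "(\<Sum>a\<in>A. \<Sum>x\<in>F. cnj (c a x) * g a x) = (\<Sum>a\<in>A. section_ip k F (g a) (g a))"
    by (simp add: section_ip_def c_def)
  also have "\<dots> = of_real T" by (simp add: ip T_def)
  finally have "norm (\<Sum>a\<in>A. \<Sum>x\<in>F. cnj (c a x) * g a x) = T"
    using T by (simp only: norm_of_real abs_of_nonneg)
  then have "T \<le> C * sqrt T" using bd[of c] unfolding T_def[symmetric] by simp
  then have le: "sqrt T * sqrt T \<le> C * sqrt T" using T by simp
  have "sqrt T \<le> C"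
  proof (cases "T = 0")
    case False
    then have "0 < sqrt T" using T by simp
    with le show ?thesis by (rule mult_right_le_imp_le)
  qed (use C in simp)
  then have "T \<le> C\<^sup>2" using T by (metis real_sqrt_le_iff real_sqrt_unique sqrt_le_D)
  moreover have "(\<Sum>a\<in>A. Re (section_ip k F (g a) (g a))) = T"
    using ip by (simp add: T_def)
  ultimately show ?thesis by simp
qed

lemma section_ip_bound:
  assumes f: "bounded_by k C f" and C: "0 \<le> C" and F: "finite F"
  shows "Re (section_ip k F f f) \<le> C\<^sup>2"
  using section_ip_family_bound[OF C _ F, of "{()}" "\<lambda>_. f"] f bounded_byD[OF f F]
  by (auto simp: rkhs_space_def)

lemma energy_cauchy_schwarz:
  assumes F: "finite F"
  shows "norm (\<Sum>x\<in>F. \<Sum>y\<in>F. cnj (c x) * k x y * d y) \<le> sqrt (energy k F d) * sqrt (energy k F c)"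
proof -
  define C where "C b = (if b then c else d)" for b
  have "(norm (\<Sum>x\<in>F. \<Sum>y\<in>F. cnj (c x) * k x y * d y))\<^sup>2 \<le> energy k F c * energy k F d"
    using pd_cauchy_schwarz[OF pd_form[OF k F, of C], of True False] by (simp add: C_def energy_def)
  then show ?thesis by (simp add: real_le_rsqrt mult.commute flip: real_sqrt_mult)
qed

lemma bounded_by_mono: "bounded_by k C f \<Longrightarrow> C \<le> D \<Longrightarrow> bounded_by k D f"
  unfolding bounded_by_def
  by (meson energy_nonneg mult_right_mono order_trans real_sqrt_ge_zero)

lemma rkhs_spaceE:
  assumes "f \<in> rkhs_space k"
  obtains C where "0 \<le> C" "bounded_by k C f"
proof -
  obtain C where C: "bounded_by k C f" using assms by (auto simp: rkhs_space_def)
  have "bounded_by k \<bar>C\<bar> f" by (rule bounded_by_mono[OF C]) simp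
  then show thesis by (rule that[OF abs_ge_zero])
qed

lemma rkhs_space_diff:
  assumes "f \<in> rkhs_space k" "g \<in> rkhs_space k"
  shows "(\<lambda>x. f x - g x) \<in> rkhs_space k"
  using rkhs_space_add[OF assms(1) rkhs_space_scale[OF assms(2), of "-1"]] by simp

lemma section_ip_self_tendsto:
  assumes f: "f \<in> rkhs_space k"
  shows "\<exists>L. ((\<lambda>F. section_ip k F f f) \<longlongrightarrow> L) finite_sets_at_top"
proof -
  obtain C where C: "0 \<le> C" "bounded_by k C f" using rkhs_spaceE[OF f] .
  have "((\<lambda>F. Re (section_ip k F f f)) \<longlongrightarrow> (SUP F\<in>{F. finite F}. Re (section_ip k F f f))) finite_sets_at_top"
    by (rule tendsto_of_mono_bounded) (auto intro: section_ip_mono[OF f] section_ip_bound[OF C(2,1)])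
  from tendsto_of_real[OF this, where 'a = complex]
  have "((\<lambda>F. of_real (Re (section_ip k F f f))) \<longlongrightarrow> complex_of_real (SUP F\<in>{F. finite F}. Re (section_ip k F f f))) finite_sets_at_top" .
  then have "((\<lambda>F. section_ip k F f f) \<longlongrightarrow> complex_of_real (SUP F\<in>{F. finite F}. Re (section_ip k F f f))) finite_sets_at_top"
    by (rule Lim_transform_eventually)
      (auto intro!: eventually_finite_subsets_at_top_weakI simp: section_ip_self[OF f])
  then show ?thesis by blast
qed

lemma section_ip_polarization:
  assumes f: "f \<in> rkhs_space k" and g: "g \<in> rkhs_space k" and F: "finite F"
  shows "(\<Sum>a\<in>{1, -1, \<i>, -\<i>}. a * section_ip k F (\<lambda>x. f x + a * g x) (\<lambda>x. f x + a * g x)) = 4 * section_ip k F f g"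
proof -
  have h: "(\<lambda>x. f x + a * g x) \<in> rkhs_space k" for a
    by (intro rkhs_space_add rkhs_space_scale f g)
  have "section_ip k F (\<lambda>x. f x + a * g x) (\<lambda>x. f x + a * g x)
     = section_ip k F f f + a * section_ip k F g f + cnj a * (section_ip k F f g + a * section_ip k F g g)" for a
  proof -
    have "section_ip k F f (\<lambda>x. f x + a * g x) = section_ip k F f f + cnj a * section_ip k F f g"
      using section_ip_sym[OF h f F, of a] section_ip_sym[OF f f F] section_ip_sym[OF g f F]
      by (simp add: section_ip_add section_ip_scale)
    moreover have "section_ip k F g (\<lambda>x. f x + a * g x) = section_ip k F g f + cnj a * section_ip k F g g"
      using section_ip_sym[OF h g F, of a] section_ip_sym[OF f g F] section_ip_sym[OF g g F]
      by (simp add: section_ip_add section_ip_scale)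
    ultimately show ?thesis by (simp add: section_ip_add section_ip_scale algebra_simps)
  qed
  moreover have "distinct [1, -1, \<i>, -\<i>]" by (auto simp: complex_eq_iff)
  ultimately show ?thesis by (simp add: algebra_simps)
qed

text \<open>Polarization reduces the existence of the limit to the diagonal case, where the net is increasing
and bounded.\<close>

lemma rkhs_ip_tendsto:
  assumes f: "f \<in> rkhs_space k" and g: "g \<in> rkhs_space k"
  shows "((\<lambda>F. section_ip k F f g) \<longlongrightarrow> rkhs_ip k f g) finite_sets_at_top"
proof -
  have "\<forall>a. \<exists>L. ((\<lambda>F. section_ip k F (\<lambda>x. f x + a * g x) (\<lambda>x. f x + a * g x)) \<longlongrightarrow> L) finite_sets_at_top"
    by (intro allI section_ip_self_tendsto rkhs_space_add rkhs_space_scale f g)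
  from choice[OF this] obtain L where
    L: "\<And>a. ((\<lambda>F. section_ip k F (\<lambda>x. f x + a * g x) (\<lambda>x. f x + a * g x)) \<longlongrightarrow> L a) finite_sets_at_top"
    by blast
  have "((\<lambda>F. (\<Sum>a\<in>{1, -1, \<i>, -\<i>}. a * section_ip k F (\<lambda>x. f x + a * g x) (\<lambda>x. f x + a * g x)) / 4)
      \<longlongrightarrow> (\<Sum>a\<in>{1, -1, \<i>, -\<i>}. a * L a) / 4) finite_sets_at_top"
    by (intro tendsto_divide tendsto_sum tendsto_mult tendsto_const L) simp
  then have "((\<lambda>F. section_ip k F f g) \<longlongrightarrow> (\<Sum>a\<in>{1, -1, \<i>, -\<i>}. a * L a) / 4) finite_sets_at_top"
    by (rule Lim_transform_eventually)
      (rule eventually_finite_subsets_at_top_weakI, simp only: section_ip_polarization[OF f g], simp)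
  then show ?thesis unfolding rkhs_ip_def
    by (metis tendsto_Lim finite_subsets_at_top_neq_bot)
qed

lemma section_ip_le_rkhs_ip:
  assumes f: "f \<in> rkhs_space k" and F: "finite F"
  shows "Re (section_ip k F f f) \<le> Re (rkhs_ip k f f)"
proof (rule tendsto_lowerbound[OF tendsto_Re[OF rkhs_ip_tendsto[OF f f]]])
  show "\<forall>\<^sub>F G in finite_sets_at_top. Re (section_ip k F f f) \<le> Re (section_ip k G f f)"
    unfolding eventually_finite_subsets_at_top
    by (rule exI[of _ F]) (use F section_ip_mono[OF f] in auto)
qed simp

lemma bounded_by_rkhs_norm:
  assumes f: "f \<in> rkhs_space k"
  shows "bounded_by k (sqrt (Re (rkhs_ip k f f))) f"
  unfolding bounded_by_def
proof (intro allI impI)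
  fix F c assume F: "finite (F :: 'a set)"
  define d where "d = interpolating_coeffs k F f"
  have "(\<Sum>x\<in>F. cnj (c x) * f x) = (\<Sum>x\<in>F. \<Sum>y\<in>F. cnj (c x) * k x y * d y)"
    using interpolating_coeffs[OF f F] by (simp add: d_def mult.assoc flip: sum_distrib_left)
  then have "norm (\<Sum>x\<in>F. cnj (c x) * f x) \<le> sqrt (energy k F d) * sqrt (energy k F c)"
    using energy_cauchy_schwarz[OF F, of c d] by simp
  also have "energy k F d \<le> Re (rkhs_ip k f f)"
    using section_ip_le_rkhs_ip[OF f F] section_ip_self[OF f F] by (simp add: d_def)
  then have "sqrt (energy k F d) * sqrt (energy k F c) \<le> sqrt (Re (rkhs_ip k f f)) * sqrt (energy k F c)"
    by (intro mult_right_mono) (auto simp: energy_nonneg F)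
  finally show "norm (\<Sum>x\<in>F. cnj (c x) * f x) \<le> sqrt (Re (rkhs_ip k f f)) * sqrt (energy k F c)" .
qed

text \<open>Membership in the ball of radius \<open>C\<close> of \<open>H \<otimes> \<complex>\<^sup>N\<close> can be tested on finitely many points at a time.
Together with the converse \<open>bounded_by_rkhs_norm\<close> this makes multipliers a matter of finite sums.\<close>

lemma rkhs_family_bound:
  assumes C: "0 \<le> C" and A: "finite A"
    and bd: "\<And>F c. finite F \<Longrightarrow> norm (\<Sum>a\<in>A. \<Sum>x\<in>F. cnj (c a x) * g a x) \<le> C * sqrt (\<Sum>a\<in>A. energy k F (c a))"
  shows "\<forall>a\<in>A. g a \<in> rkhs_space k" and "(\<Sum>a\<in>A. Re (rkhs_ip k (g a) (g a))) \<le> C\<^sup>2"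
proof -
  show g: "\<forall>a\<in>A. g a \<in> rkhs_space k"
  proof
    fix a assume a: "a \<in> A"
    have "bounded_by k C (g a)"
      unfolding bounded_by_def
    proof (intro allI impI)
      fix F c assume F: "finite (F :: 'a set)"
      have 1: "(\<Sum>b\<in>A. \<Sum>x\<in>F. cnj ((if b = a then c else (\<lambda>x. 0)) x) * g b x) = (\<Sum>x\<in>F. cnj (c x) * g a x)"
      proof -
        have "(\<Sum>b\<in>A. \<Sum>x\<in>F. cnj ((if b = a then c else (\<lambda>x. 0)) x) * g b x)
           = (\<Sum>b\<in>A. if b = a then \<Sum>x\<in>F. cnj (c x) * g b x else 0)"
          by (rule sum.cong) auto
        then show ?thesis using A a by simp
      qed
      have 2: "(\<Sum>b\<in>A. energy k F (if b = a then c else (\<lambda>x. 0))) = energy k F c"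
      proof -
        have "(\<Sum>b\<in>A. energy k F (if b = a then c else (\<lambda>x. 0))) = (\<Sum>b\<in>A. if b = a then energy k F c else 0)"
          by (rule sum.cong) (auto simp: energy_def)
        then show ?thesis using A a by simp
      qed
      show "norm (\<Sum>x\<in>F. cnj (c x) * g a x) \<le> C * sqrt (energy k F c)"
        using bd[OF F, of "\<lambda>b. if b = a then c else (\<lambda>x. 0)"] unfolding 1 2 .
    qed
    then show "g a \<in> rkhs_space k" by (auto simp: rkhs_space_def)
  qed
  show "(\<Sum>a\<in>A. Re (rkhs_ip k (g a) (g a))) \<le> C\<^sup>2"
  proof (rule tendsto_upperbound)
    show "((\<lambda>F. \<Sum>a\<in>A. Re (section_ip k F (g a) (g a))) \<longlongrightarrow> (\<Sum>a\<in>A. Re (rkhs_ip k (g a) (g a)))) finite_sets_at_top"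
      by (intro tendsto_sum tendsto_Re rkhs_ip_tendsto) (use g in auto)
    show "\<forall>\<^sub>F F in finite_sets_at_top. (\<Sum>a\<in>A. Re (section_ip k F (g a) (g a))) \<le> C\<^sup>2"
      by (rule eventually_finite_subsets_at_top_weakI, rule section_ip_family_bound[OF C A])
        (use g bd in auto)
  qed simp
qed

lemma rkhs_norm_le:
  assumes "bounded_by k C f" "0 \<le> C"
  shows "sqrt (Re (rkhs_ip k f f)) \<le> C"
  using rkhs_family_bound(2)[of C "{()}" "\<lambda>_. f"] assms bounded_byD[OF assms(1)]
  by (simp add: real_le_lsqrt)

text \<open>Boundedness with a given constant survives pointwise limits, and norm-Cauchy sequences converge
pointwise.\<close>

lemma rkhs_complete:
  assumes F: "\<And>n. F n \<in> rkhs_space k"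
    and cauchy: "\<And>e. e > 0 \<Longrightarrow> \<exists>M. \<forall>m\<ge>M. \<forall>n\<ge>M.
      sqrt (Re (rkhs_ip k (\<lambda>x. F m x - F n x) (\<lambda>x. F m x - F n x))) < e"
  shows "\<exists>f\<in>rkhs_space k. (\<lambda>n::nat. sqrt (Re (rkhs_ip k (\<lambda>x. F n x - f x) (\<lambda>x. F n x - f x)))) \<longlonglongrightarrow> 0"
proof -
  have bd: "\<exists>M. \<forall>m\<ge>M. \<forall>n\<ge>M. bounded_by k e (\<lambda>x. F m x - F n x)" if "e > 0" for e
    using cauchy[OF that] bounded_by_mono[OF bounded_by_rkhs_norm[OF rkhs_space_diff[OF F F]]]
    by (meson less_imp_le)
  have "Cauchy (\<lambda>n. F n y)" for y
  proof (rule CauchyI)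
    fix e :: real assume e: "0 < e"
    define s where "s = sqrt (Re (k y y))"
    have s: "0 \<le> s" using pd_diag_real(2)[OF k] by (simp add: s_def)
    have e': "e / (s + 1) > 0" using e s by simp
    obtain M where M: "\<forall>m\<ge>M. \<forall>n\<ge>M. bounded_by k (e / (s + 1)) (\<lambda>x. F m x - F n x)"
      using bd[OF e'] by blast
    have "norm (F m y - F n y) < e" if "m \<ge> M" "n \<ge> M" for m n
    proof -
      have "norm (F m y - F n y) \<le> e / (s + 1) * s"
        using bounded_byD[of "e / (s + 1)" "\<lambda>x. F m x - F n x" "{y}" "\<lambda>_. 1"] M that
        by (simp add: energy_def s_def)
      also have "\<dots> < e" using e s by (simp add: field_simps)
      finally show ?thesis .
    qed
    then show "\<exists>M. \<forall>m\<ge>M. \<forall>n\<ge>M. norm (F m y - F n y) < e" by blast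
  qed
  then have "\<forall>y. \<exists>l. (\<lambda>n. F n y) \<longlonglongrightarrow> l"
    by (auto simp: Cauchy_convergent_iff convergent_def)
  from choice[OF this] obtain f where f: "\<And>y. (\<lambda>n. F n y) \<longlonglongrightarrow> f y" by blast
  have lim_bd: "bounded_by k e (\<lambda>x. f x - F n x)"
    if M: "\<forall>m\<ge>M. \<forall>n\<ge>M. bounded_by k e (\<lambda>x. F m x - F n x)" and n: "n \<ge> M" for e M n
    unfolding bounded_by_def
  proof (intro allI impI)
    fix G c assume G: "finite (G :: 'a set)"
    have "(\<lambda>m. norm (\<Sum>x\<in>G. cnj (c x) * (F m x - F n x))) \<longlonglongrightarrow> norm (\<Sum>x\<in>G. cnj (c x) * (f x - F n x))"
      by (intro tendsto_norm tendsto_sum tendsto_mult tendsto_diff tendsto_const f)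
    then show "norm (\<Sum>x\<in>G. cnj (c x) * (f x - F n x)) \<le> e * sqrt (energy k G c)"
      by (rule LIMSEQ_le_const2) (use M n bounded_byD[OF _ G] in blast)
  qed
  obtain M where M: "\<forall>m\<ge>M. \<forall>n\<ge>M. bounded_by k 1 (\<lambda>x. F m x - F n x)"
    using bd[of 1] by auto
  have "(\<lambda>x. f x - F M x) \<in> rkhs_space k"
    using lim_bd[OF M order_refl] by (auto simp: rkhs_space_def)
  from rkhs_space_add[OF this F[of M]] have fH: "f \<in> rkhs_space k" by simp
  have "(\<lambda>n. sqrt (Re (rkhs_ip k (\<lambda>x. F n x - f x) (\<lambda>x. F n x - f x)))) \<longlonglongrightarrow> 0"
  proof (rule LIMSEQ_I)
    fix e :: real assume e: "0 < e"
    then obtain M where M: "\<forall>m\<ge>M. \<forall>n\<ge>M. bounded_by k (e / 2) (\<lambda>x. F m x - F n x)"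
      using bd[of "e / 2"] by auto
    have "norm (sqrt (Re (rkhs_ip k (\<lambda>x. F n x - f x) (\<lambda>x. F n x - f x))) - 0) < e" if "n \<ge> M" for n
    proof -
      have "bounded_by k (e / 2) (\<lambda>x. F n x - f x)"
        using bounded_by_scale[OF lim_bd[OF M that], of "-1"] by simp
      then have "sqrt (Re (rkhs_ip k (\<lambda>x. F n x - f x) (\<lambda>x. F n x - f x))) \<le> e / 2"
        by (rule rkhs_norm_le) (use e in simp)
      moreover have "0 \<le> Re (rkhs_ip k (\<lambda>x. F n x - f x) (\<lambda>x. F n x - f x))"
        using section_ip_le_rkhs_ip[OF rkhs_space_diff[OF F fH], of "{}"] by (simp add: section_ip_def)
      ultimately show ?thesis using e by simp
    qed
    then show "\<exists>no. \<forall>n\<ge>no. norm (sqrt (Re (rkhs_ip k (\<lambda>x. F n x - f x) (\<lambda>x. F n x - f x))) - 0) < e" by blast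
  qed
  with fH show ?thesis by blast
qed

theorem moore_aronszajn: "rkhs k (rkhs_space k) (rkhs_ip k)"
proof
  note uniq = tendsto_unique[OF finite_subsets_at_top_neq_bot]
  show "(\<lambda>x. 0) \<in> rkhs_space k" by (rule rkhs_space_zero)
  show "(\<lambda>x. f x + g x) \<in> rkhs_space k" if "f \<in> rkhs_space k" "g \<in> rkhs_space k" for f g
    using that by (rule rkhs_space_add)
  show "(\<lambda>x. c * f x) \<in> rkhs_space k" if "f \<in> rkhs_space k" for c f
    using that by (rule rkhs_space_scale)
  show "rkhs_ip k (\<lambda>x. f x + g x) h = rkhs_ip k f h + rkhs_ip k g h"
    if "f \<in> rkhs_space k" "g \<in> rkhs_space k" "h \<in> rkhs_space k" for f g h
    using rkhs_ip_tendsto[OF rkhs_space_add[OF that(1,2)] that(3)]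
      tendsto_add[OF rkhs_ip_tendsto[OF that(1,3)] rkhs_ip_tendsto[OF that(2,3)]]
    unfolding section_ip_add by (rule uniq)
  show "rkhs_ip k (\<lambda>x. c * f x) g = c * rkhs_ip k f g"
    if "f \<in> rkhs_space k" "g \<in> rkhs_space k" for c f g
    using rkhs_ip_tendsto[OF rkhs_space_scale[OF that(1)] that(2)]
      tendsto_mult[OF tendsto_const rkhs_ip_tendsto[OF that]]
    unfolding section_ip_scale by (rule uniq)
  show "rkhs_ip k g f = cnj (rkhs_ip k f g)" if "f \<in> rkhs_space k" "g \<in> rkhs_space k" for f g
  proof (rule uniq[OF rkhs_ip_tendsto[OF that(2,1)]])
    show "((\<lambda>F. section_ip k F g f) \<longlongrightarrow> cnj (rkhs_ip k f g)) finite_sets_at_top"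
      by (rule Lim_transform_eventually[OF tendsto_cnj[OF rkhs_ip_tendsto[OF that]]])
        (rule eventually_finite_subsets_at_top_weakI, simp add: section_ip_sym[OF that])
  qed
  then have real: "Im (rkhs_ip k f f) = 0" if "f \<in> rkhs_space k" for f
    using that by (metis complex_cnj_cancel_iff Reals_cnj_iff complex_is_Real_iff)
  show nonneg: "0 \<le> rkhs_ip k f f" if "f \<in> rkhs_space k" for f
    using section_ip_le_rkhs_ip[OF that, of "{}"] real[OF that] by (simp add: section_ip_def less_eq_complex_def)
  show "f = (\<lambda>x. 0)" if "f \<in> rkhs_space k" "rkhs_ip k f f = 0" for f
  proof
    fix y
    show "f y = 0" using bounded_byD[OF bounded_by_rkhs_norm[OF that(1)], of "{y}" "\<lambda>_. 1"] that(2) by simp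
  qed
  show "\<exists>f\<in>rkhs_space k. (\<lambda>n. sqrt (Re (rkhs_ip k (\<lambda>x. F n x - f x) (\<lambda>x. F n x - f x)))) \<longlonglongrightarrow> 0"
    if "\<And>n. F n \<in> rkhs_space k" "\<And>e. e > 0 \<Longrightarrow> \<exists>M. \<forall>m\<ge>M. \<forall>n\<ge>M.
      sqrt (Re (rkhs_ip k (\<lambda>x. F m x - F n x) (\<lambda>x. F m x - F n x))) < e" for F :: "nat \<Rightarrow> 'a \<Rightarrow> complex"
    using that by (rule rkhs_complete)
  show "(\<lambda>x. k x y) \<in> rkhs_space k" for y by (rule rkhs_space_kernel)
  show "rkhs_ip k f (\<lambda>x. k x y) = f y" if f: "f \<in> rkhs_space k" for f y
  proof (rule uniq[OF rkhs_ip_tendsto[OF f rkhs_space_kernel]])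
    have "section_ip k F f (\<lambda>x. k x y) = f y" if F: "finite F" "y \<in> F" for F
    proof -
      have "section_ip k F f (\<lambda>x. k x y) = (\<Sum>x\<in>F. cnj (if x = y then 1 else 0) * f x)"
        by (rule section_ip_eq[OF f F(1) _ rkhs_space_kernel])
          (use F in \<open>simp add: if_distrib[of "\<lambda>u. _ * u"] cong: if_cong\<close>)
      then show ?thesis using F by (simp add: if_distrib[of "\<lambda>u. u * _"] if_distrib[of cnj] cong: if_cong)
    qed
    then have "\<forall>\<^sub>F F in finite_sets_at_top. f y = section_ip k F f (\<lambda>x. k x y)"
      unfolding eventually_finite_subsets_at_top by (intro exI[of _ "{y}"]) auto
    then show "((\<lambda>F. section_ip k F f (\<lambda>x. k x y)) \<longlongrightarrow> f y) finite_sets_at_top"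
      by (rule Lim_transform_eventually[OF tendsto_const])
  qed
qed

end

section \<open>Complete Pick kernels from the normalized form\<close>

lemma sum_rotate: "(\<Sum>x\<in>A. \<Sum>y\<in>B. \<Sum>d\<in>D. h x y d) = (\<Sum>d\<in>D. \<Sum>x\<in>A. \<Sum>y\<in>B. h x y d)"
  by (simp only: sum.swap[of _ D B]) (rule sum.swap)

text \<open>The form of the kernel \<open>s * \<phi> \<phi>*\<close> at \<open>c\<close> is the form of \<open>s\<close> at the image of \<open>c\<close> under \<open>\<phi>*\<close>.\<close>

lemma form_of_image:
  fixes s :: "'a \<Rightarrow> 'a \<Rightarrow> complex"
  shows "(\<Sum>x\<in>F. \<Sum>a\<in>A. \<Sum>y\<in>F. \<Sum>b\<in>A. cnj (c a x) * (s x y * (\<phi> x a * cnj (\<phi> y b))) * c b y)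
    = (\<Sum>x\<in>F. \<Sum>y\<in>F. cnj (\<Sum>a\<in>A. cnj (\<phi> x a) * c a x) * s x y * (\<Sum>b\<in>A. cnj (\<phi> y b) * c b y))"
proof (intro sum.cong refl)
  fix x
  have "(\<Sum>a\<in>A. \<Sum>y\<in>F. \<Sum>b\<in>A. cnj (c a x) * (s x y * (\<phi> x a * cnj (\<phi> y b))) * c b y)
     = (\<Sum>a\<in>A. (cnj (c a x) * \<phi> x a) * (\<Sum>y\<in>F. s x y * (\<Sum>b\<in>A. cnj (\<phi> y b) * c b y)))"
    by (simp add: sum_distrib_left mult_ac)
  also have "\<dots> = cnj (\<Sum>a\<in>A. cnj (\<phi> x a) * c a x) * (\<Sum>y\<in>F. s x y * (\<Sum>b\<in>A. cnj (\<phi> y b) * c b y))"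
    by (subst sum_distrib_right[symmetric]) (simp add: mult.commute)
  also have "\<dots> = (\<Sum>y\<in>F. cnj (\<Sum>a\<in>A. cnj (\<phi> x a) * c a x) * s x y * (\<Sum>b\<in>A. cnj (\<phi> y b) * c b y))"
    by (simp add: sum_distrib_left mult.assoc del: cnj_sum)
  finally show "(\<Sum>a\<in>A. \<Sum>y\<in>F. \<Sum>b\<in>A. cnj (c a x) * (s x y * (\<phi> x a * cnj (\<phi> y b))) * c b y)
     = (\<Sum>y\<in>F. cnj (\<Sum>a\<in>A. cnj (\<phi> x a) * c a x) * s x y * (\<Sum>b\<in>A. cnj (\<phi> y b) * c b y))" .
qed

text \<open>Positivity of \<open>s (1 - \<Phi> \<Phi>*)\<close> says that the adjoint \<open>\<Phi>*\<close> is contractive on coefficient families.\<close>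

lemma energy_contraction:
  fixes N :: nat and s :: "'a \<Rightarrow> 'a \<Rightarrow> complex"
  assumes \<Phi>: "pd (UNIV \<times> {..<N}) (\<lambda>(x, a) (y, b).
      s x y * ((if a = b then 1 else 0) - (\<Sum>c<N. \<Phi> x a c * cnj (\<Phi> y b c))))"
    and F: "finite F"
  shows "(\<Sum>d<N. energy s F (\<lambda>x. \<Sum>a<N. cnj (\<Phi> x a d) * c a x)) \<le> (\<Sum>a<N. energy s F (c a))"
proof -
  have "0 \<le> (\<Sum>p\<in>F \<times> {..<N}. \<Sum>q\<in>F \<times> {..<N}. cnj (c (snd p) (fst p)) *
      (\<lambda>(x, a) (y, b). s x y * ((if a = b then 1 else 0) - (\<Sum>c<N. \<Phi> x a c * cnj (\<Phi> y b c)))) p q * c (snd q) (fst q))"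
    by (rule pdD[OF \<Phi>]) (use F in auto)
  also have "\<dots> = (\<Sum>x\<in>F. \<Sum>a<N. \<Sum>y\<in>F. \<Sum>b<N. cnj (c a x) *
      (s x y * ((if a = b then 1 else 0) - (\<Sum>d<N. \<Phi> x a d * cnj (\<Phi> y b d)))) * c b y)"
    by (simp only: sum.cartesian_product' fst_conv snd_conv prod.case)
  also have "\<dots> = (\<Sum>x\<in>F. \<Sum>a<N. \<Sum>y\<in>F. \<Sum>b<N. cnj (c a x) * (s x y * (if a = b then 1 else 0)) * c b y)
      - (\<Sum>x\<in>F. \<Sum>a<N. \<Sum>y\<in>F. \<Sum>b<N. \<Sum>d<N. cnj (c a x) * (s x y * (\<Phi> x a d * cnj (\<Phi> y b d))) * c b y)"
    by (simp only: right_diff_distrib left_diff_distrib sum_subtractf sum_distrib_left sum_distrib_right)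
  also have "(\<Sum>x\<in>F. \<Sum>a<N. \<Sum>y\<in>F. \<Sum>b<N. cnj (c a x) * (s x y * (if a = b then 1 else 0)) * c b y)
      = (\<Sum>a<N. \<Sum>x\<in>F. \<Sum>y\<in>F. cnj (c a x) * s x y * c a y)"
    by (subst sum.swap) (simp add: if_distrib[of "\<lambda>u. _ * u"] if_distrib[of "\<lambda>u. u * _"] cong: if_cong)
  also have "(\<Sum>x\<in>F. \<Sum>a<N. \<Sum>y\<in>F. \<Sum>b<N. \<Sum>d<N. cnj (c a x) * (s x y * (\<Phi> x a d * cnj (\<Phi> y b d))) * c b y)
      = (\<Sum>d<N. \<Sum>x\<in>F. \<Sum>a<N. \<Sum>y\<in>F. \<Sum>b<N. cnj (c a x) * (s x y * (\<Phi> x a d * cnj (\<Phi> y b d))) * c b y)"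
    using sum_rotate[of "\<lambda>p q d. cnj (c (snd p) (fst p)) * (s (fst p) (fst q) * (\<Phi> (fst p) (snd p) d * cnj (\<Phi> (fst q) (snd q) d))) * c (snd q) (fst q)"
        "{..<N}" "F \<times> {..<N}" "F \<times> {..<N}"]
    by (simp only: sum.cartesian_product' fst_conv snd_conv)
  also have "\<dots> = (\<Sum>d<N. \<Sum>x\<in>F. \<Sum>y\<in>F. cnj (\<Sum>a<N. cnj (\<Phi> x a d) * c a x) * s x y * (\<Sum>b<N. cnj (\<Phi> y b d) * c b y))"
    unfolding form_of_image ..
  finally show ?thesis by (simp add: less_eq_complex_def energy_def)
qed

text \<open>The functional of \<open>\<Phi> f\<close> at a coefficient family \<open>c\<close> is the functional of \<open>f\<close> at \<open>\<Phi>* c\<close>. Hence a bound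
for \<open>f\<close> is inherited by \<open>\<Phi> f\<close>, which gives membership and the norm inequality at the same time.\<close>

theorem contractive_multiplier_of_pd:
  fixes s :: "'a \<Rightarrow> 'a \<Rightarrow> complex" and N :: nat
  assumes s: "pd UNIV s"
    and \<Phi>: "pd (UNIV \<times> {..<N}) (\<lambda>(x, a) (y, b).
      s x y * ((if a = b then 1 else 0) - (\<Sum>c<N. \<Phi> x a c * cnj (\<Phi> y b c))))"
  shows "contractive_multiplier (rkhs_space s) (rkhs_ip s) N (\<lambda>x. mat N N (\<lambda>(a, c). \<Phi> x a c))"
  unfolding contractive_multiplier_def
proof (intro conjI allI ballI)
  fix x show "mat N N (\<lambda>(a, c). \<Phi> x a c) \<in> carrier_mat N N" by simp
next
  fix f assume f: "f \<in> tensor_space (rkhs_space s) N"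
  define G where "G a x = (\<Sum>d<N. \<Phi> x a d * f x $ d)" for a x
  have fc: "f x \<in> carrier_vec N" "a < N \<Longrightarrow> (\<lambda>x. f x $ a) \<in> rkhs_space s" for x a
    using f by (auto simp: tensor_space_def)
  have comp: "(mat N N (\<lambda>(a, c). \<Phi> x a c) *\<^sub>v f x) $ a = G a x" if "a < N" for a x
    using that fc(1)[of x] by (simp add: scalar_prod_def G_def lessThan_atLeast0)
  define nf where "nf d = Re (rkhs_ip s (\<lambda>x. f x $ d) (\<lambda>x. f x $ d))" for d
  have nf: "0 \<le> nf d" if "d < N" for d
    using rkhs.ip_nonneg[OF moore_aronszajn[OF s] fc(2)[OF that]]
    by (simp add: nf_def less_eq_complex_def)
  define C where "C = sqrt (\<Sum>d<N. nf d)"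
  have C: "0 \<le> C" using nf by (auto simp: C_def intro!: sum_nonneg)
  have bd: "norm (\<Sum>a<N. \<Sum>x\<in>F. cnj (c a x) * G a x) \<le> C * sqrt (\<Sum>a<N. energy s F (c a))"
    if F: "finite F" for F c
  proof -
    define e where "e d x = (\<Sum>a<N. cnj (\<Phi> x a d) * c a x)" for d x
    have "(\<Sum>a<N. \<Sum>x\<in>F. cnj (c a x) * G a x) = (\<Sum>a<N. \<Sum>x\<in>F. \<Sum>d<N. cnj (c a x) * \<Phi> x a d * f x $ d)"
      by (simp add: G_def sum_distrib_left mult.assoc)
    also have "\<dots> = (\<Sum>d<N. \<Sum>x\<in>F. \<Sum>a<N. cnj (c a x) * \<Phi> x a d * f x $ d)"
      by (subst sum.swap) (rule sum_rotate)
    also have "\<dots> = (\<Sum>d<N. \<Sum>x\<in>F. cnj (e d x) * f x $ d)"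
      by (simp add: e_def sum_distrib_left sum_distrib_right mult_ac)
    finally have "norm (\<Sum>a<N. \<Sum>x\<in>F. cnj (c a x) * G a x) \<le> (\<Sum>d<N. norm (\<Sum>x\<in>F. cnj (e d x) * f x $ d))"
      by (simp add: norm_sum)
    also have "\<dots> \<le> (\<Sum>d<N. \<bar>sqrt (nf d)\<bar> * \<bar>sqrt (energy s F (e d))\<bar>)"
    proof (rule sum_mono)
      fix d assume "d \<in> {..<N}"
      then have d: "d < N" by simp
      show "norm (\<Sum>x\<in>F. cnj (e d x) * f x $ d) \<le> \<bar>sqrt (nf d)\<bar> * \<bar>sqrt (energy s F (e d))\<bar>"
        using bounded_byD[OF s bounded_by_rkhs_norm[OF s fc(2)[OF d]] F, of "e d"]
          nf[OF d] energy_nonneg[OF s F, of "e d"] by (simp add: nf_def)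
    qed
    also have "\<dots> \<le> L2_set (\<lambda>d. sqrt (nf d)) {..<N} * L2_set (\<lambda>d. sqrt (energy s F (e d))) {..<N}"
      by (rule L2_set_mult_ineq)
    also have "\<dots> = C * sqrt (\<Sum>d<N. energy s F (e d))"
      using nf energy_nonneg[OF s F] by (simp add: L2_set_def C_def)
    also have "\<dots> \<le> C * sqrt (\<Sum>a<N. energy s F (c a))"
      using energy_contraction[OF \<Phi> F, of c] C by (intro mult_left_mono) (auto simp: e_def[abs_def])
    finally show ?thesis .
  qed
  note G = rkhs_family_bound[OF s C finite_lessThan bd]
  have comp_fun: "(\<lambda>x. (mat N N (\<lambda>(a, c). \<Phi> x a c) *\<^sub>v f x) $ a) = G a" if "a < N" for a
    using comp[OF that] by (rule ext)
  show "(\<lambda>x. mat N N (\<lambda>(a, c). \<Phi> x a c) *\<^sub>v f x) \<in> tensor_space (rkhs_space s) N"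
    unfolding tensor_space_def
  proof (intro CollectI conjI allI impI)
    fix x show "mat N N (\<lambda>(a, c). \<Phi> x a c) *\<^sub>v f x \<in> carrier_vec N"
      by (rule mult_mat_vec_carrier[OF mat_carrier fc(1)])
  next
    fix a assume a: "a < N"
    show "(\<lambda>x. (mat N N (\<lambda>(a, c). \<Phi> x a c) *\<^sub>v f x) $ a) \<in> rkhs_space s"
      unfolding comp_fun[OF a] using G(1) a by simp
  qed
  have "(\<Sum>a<N. Re (rkhs_ip s (\<lambda>x. (mat N N (\<lambda>(a, c). \<Phi> x a c) *\<^sub>v f x) $ a) (\<lambda>x. (mat N N (\<lambda>(a, c). \<Phi> x a c) *\<^sub>v f x) $ a)))
     = (\<Sum>a<N. Re (rkhs_ip s (G a) (G a)))"
    by (rule sum.cong) (simp_all only: comp_fun lessThan_iff)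
  also have "\<dots> \<le> C\<^sup>2" by (rule G(2))
  finally have "tensor_norm (rkhs_ip s) N (\<lambda>x. mat N N (\<lambda>(a, c). \<Phi> x a c) *\<^sub>v f x) \<le> sqrt (C\<^sup>2)"
    unfolding tensor_norm_def by (rule real_sqrt_le_mono)
  also have "sqrt (C\<^sup>2) = tensor_norm (rkhs_ip s) N f"
    using C unfolding tensor_norm_def C_def nf_def by (simp only: real_sqrt_abs abs_of_nonneg)
  finally show "tensor_norm (rkhs_ip s) N (\<lambda>x. mat N N (\<lambda>(a, c). \<Phi> x a c) *\<^sub>v f x) \<le> tensor_norm (rkhs_ip s) N f" .
qed

lemma pick_matrix_entry:
  assumes "W i \<in> carrier_mat N N" "W j \<in> carrier_mat N N" "a < N" "b < N"
  shows "pick_matrix s N z W (i, a) (j, b)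
    = s (z i) (z j) * ((if a = b then 1 else 0) - (\<Sum>c<N. W i $$ (a, c) * cnj (W j $$ (b, c))))"
proof -
  have "mat_adjoint (W j) $$ (c, b) = cnj (W j $$ (b, c))" if "c < N" for c
    using assms that by (simp add: mat_adjoint_def mat_of_rows_index)
  then have "(W i * mat_adjoint (W j)) $$ (a, b) = (\<Sum>c<N. W i $$ (a, c) * cnj (W j $$ (b, c)))"
    using assms by (simp add: scalar_prod_def lessThan_atLeast0 mat_adjoint_def)
  then show ?thesis using assms by (simp add: pick_matrix_def mat_adjoint_def)
qed

text \<open>Dividing by \<open>\<kappa> \<kappa>*\<close> turns the Pick matrix of the kernel into the matrix required by
\<open>pick_interpolation\<close>.\<close>

theorem complete_pick_of_normalized_form:
  fixes p :: "'a \<Rightarrow> 'a \<Rightarrow> complex"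
  assumes p: "pd UNIV p" and lt: "\<And>x. Re (p x x) < 1" and \<kappa>: "\<And>x. \<kappa> x \<noteq> 0"
  shows "complete_pick_kernel (\<lambda>x y. \<kappa> x * cnj (\<kappa> y) / (1 - p x y))"
proof -
  define s where "s x y = \<kappa> x * cnj (\<kappa> y) / (1 - p x y)" for x y
  have s: "pd UNIV s"
    using pd_congruence[OF pd_inverse_one_minus[OF p lt], of \<kappa>] by (simp add: s_def[abs_def])
  have "\<exists>\<Phi>. contractive_multiplier (rkhs_space s) (rkhs_ip s) N \<Phi> \<and> (\<forall>i<n. \<Phi> (z i) = W i)"
    if W: "\<forall>i<n. W i \<in> carrier_mat N N" and pick: "psd_on ({..<n} \<times> {..<N}) (pick_matrix s N z W)"
    for n N z W
  proof -
    have "pd ({..<n} \<times> {..<N}) (\<lambda>t u. (1 / \<kappa> (z (fst t))) * pick_matrix s N z W t u * cnj (1 / \<kappa> (z (fst u))))"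
      using pick by (intro pd_congruence) (simp add: psd_on_iff_pd)
    then have "pd ({..<n} \<times> {..<N}) (\<lambda>(i, a) (j, b).
       ((if a = b then 1 else 0) - (\<Sum>c<N. W i $$ (a, c) * cnj (W j $$ (b, c)))) / (1 - p (z i) (z j)))"
    proof (rule pd_cong)
      fix t u assume "t \<in> {..<n} \<times> {..<N}" "u \<in> {..<n} \<times> {..<N}"
      then obtain i a j b where tu: "t = (i, a)" "u = (j, b)" "i < n" "a < N" "j < n" "b < N" by auto
      have w: "W i \<in> carrier_mat N N" "W j \<in> carrier_mat N N" using W tu by auto
      show "(\<lambda>(i, a) (j, b). ((if a = b then 1 else 0) - (\<Sum>c<N. W i $$ (a, c) * cnj (W j $$ (b, c)))) / (1 - p (z i) (z j))) t u
        = 1 / \<kappa> (z (fst t)) * pick_matrix s N z W t u * cnj (1 / \<kappa> (z (fst u)))"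
        unfolding tu(1,2) pick_matrix_entry[OF w tu(4,6)] using \<kappa> by (simp add: s_def)
    qed
    from pick_interpolation[OF p lt this] obtain \<Phi> where
      node: "\<forall>i<n. \<forall>a<N. \<forall>c<N. \<Phi> (z i) a c = W i $$ (a, c)" and
      \<Phi>: "pd (UNIV \<times> {..<N}) (\<lambda>(x, a) (y, b). ((if a = b then 1 else 0) - (\<Sum>c<N. \<Phi> x a c * cnj (\<Phi> y b c))) / (1 - p x y))"
      by auto
    have "pd (UNIV \<times> {..<N}) (\<lambda>(x, a) (y, b). s x y * ((if a = b then 1 else 0) - (\<Sum>c<N. \<Phi> x a c * cnj (\<Phi> y b c))))"
      by (rule pd_cong[OF pd_congruence[OF \<Phi>, of "\<lambda>t. \<kappa> (fst t)"]]) (auto simp: s_def)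
    from contractive_multiplier_of_pd[OF s this]
    have "contractive_multiplier (rkhs_space s) (rkhs_ip s) N (\<lambda>x. mat N N (\<lambda>(a, c). \<Phi> x a c))" .
    moreover have "mat N N (\<lambda>(a, c). \<Phi> (z i) a c) = W i" if "i < n" for i
      using W node that by (intro eq_matI) auto
    ultimately show ?thesis by blast
  qed
  then have "complete_pick_kernel s"
    unfolding complete_pick_kernel_def is_kernel_iff_pd using s moore_aronszajn[OF s] by blast
  then show ?thesis by (simp add: s_def[abs_def])
qed

section \<open>The normalized form from the complete Pick property\<close>

context rkhs
begin

lemma lincomb_mem: "(\<And>i. i \<in> I \<Longrightarrow> K i \<in> H) \<Longrightarrow> (\<lambda>x. \<Sum>i\<in>I. c i * K i x) \<in> H"
proof (induction I rule: infinite_finite_induct)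
  case (insert i I)
  then have "(\<lambda>x. c i * K i x) \<in> H" "(\<lambda>x. \<Sum>i\<in>I. c i * K i x) \<in> H" by (auto intro: scale_mem)
  from add_mem[OF this] show ?case using insert by simp
qed (auto intro: zero_mem)

lemma ip_zero: "g \<in> H \<Longrightarrow> ip (\<lambda>x. 0) g = 0"
  using ip_scale[OF zero_mem, of g 0] by simp

lemma ip_lincomb_left:
  "(\<And>i. i \<in> I \<Longrightarrow> K i \<in> H) \<Longrightarrow> g \<in> H \<Longrightarrow> ip (\<lambda>x. \<Sum>i\<in>I. c i * K i x) g = (\<Sum>i\<in>I. c i * ip (K i) g)"
  by (induction I rule: infinite_finite_induct) (simp_all add: ip_zero ip_add ip_scale scale_mem lincomb_mem)

lemma ip_lincomb_right:
  assumes "\<And>i. i \<in> I \<Longrightarrow> K i \<in> H" "g \<in> H"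
  shows "ip g (\<lambda>x. \<Sum>i\<in>I. c i * K i x) = (\<Sum>i\<in>I. cnj (c i) * ip g (K i))"
proof -
  have "ip g (\<lambda>x. \<Sum>i\<in>I. c i * K i x) = cnj (\<Sum>i\<in>I. c i * ip (K i) g)"
    using ip_sym[OF lincomb_mem[of I K c] assms(2)] ip_lincomb_left[of I K g c] assms by simp
  also have "\<dots> = (\<Sum>i\<in>I. cnj (c i) * ip g (K i))"
    using ip_sym[OF assms(1) assms(2)] by simp
  finally show ?thesis .
qed

lemma diff_mem: "f \<in> H \<Longrightarrow> g \<in> H \<Longrightarrow> (\<lambda>x. f x - g x) \<in> H"
  using add_mem[OF _ scale_mem[of g "-1"], of f] by simp

lemma ip_diff_left: "f \<in> H \<Longrightarrow> g \<in> H \<Longrightarrow> h \<in> H \<Longrightarrow> ip (\<lambda>x. f x - g x) h = ip f h - ip g h"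
  using ip_add[OF _ scale_mem[of g "-1"], of f h] ip_scale[of g h "-1"] by simp

lemma ip_diff_right: "f \<in> H \<Longrightarrow> g \<in> H \<Longrightarrow> h \<in> H \<Longrightarrow> ip h (\<lambda>x. f x - g x) = ip h f - ip h g"
  using ip_sym[OF diff_mem[of f g], of h] ip_sym[of f h] ip_sym[of g h] by (simp add: ip_diff_left)

lemma ip_real: "f \<in> H \<Longrightarrow> ip f f = of_real (Re (ip f f))"
  using ip_nonneg[of f] by (simp add: less_eq_complex_def complex_eq_iff)

lemma kernel_at_mem: "(\<lambda>x. kernel_at k z x y) \<in> H"
  unfolding kernel_at_def
  using diff_mem[OF kernel_mem[of y] scale_mem[OF kernel_mem[of z], of "k z y / k z z"]] 
  by (simp add: mult.commute)

text \<open>\<open>k\<^sup>z\<close> is the reproducing kernel of the subspace of functions vanishing at \<open>z\<close>.\<close>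

lemma kernel_at_reproducing:
  assumes "u \<in> H" "u z = 0"
  shows "ip u (\<lambda>x. kernel_at k z x y) = u y"
proof -
  have "(\<lambda>x. kernel_at k z x y) = (\<lambda>x. k x y - (\<lambda>x. (k z y / k z z) * k x z) x)"
    by (simp add: kernel_at_def mult.commute)
  moreover have "ip u (\<lambda>x. k x y - (\<lambda>x. (k z y / k z z) * k x z) x)
     = ip u (\<lambda>x. k x y) - ip u (\<lambda>x. (k z y / k z z) * k x z)"
    by (rule ip_diff_right) (intro kernel_mem scale_mem assms)+
  moreover have "ip u (\<lambda>x. (k z y / k z z) * k x z) = 0"
  proof -
    have "ip (\<lambda>x. k x z) u = 0"
      by (subst ip_sym[OF assms(1) kernel_mem]) (simp add: reproducing[OF assms(1)] assms(2))
    then have "ip (\<lambda>x. (k z y / k z z) * k x z) u = 0"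
      by (subst ip_scale[OF kernel_mem assms(1)]) simp
    then show ?thesis by (subst ip_sym[OF scale_mem[OF kernel_mem] assms(1)]) simp
  qed
  ultimately show ?thesis using reproducing[OF assms(1), of y] by simp
qed

lemma kernel_at_vanishes: "k z z \<noteq> 0 \<Longrightarrow> kernel_at k z z y = 0"
  by (simp add: kernel_at_def)

text \<open>A multiplier leaves the subspace of functions vanishing at \<open>z\<close> invariant, so the kernel \<open>k\<^sup>z\<close> of that
subspace inherits the positivity; only the corner entry of \<open>k\<^sup>z (1 - \<Phi> \<Phi>*)\<close> is recorded. With
\<open>g = \<Sum>y. c y * k\<^sup>z\<^sub>y\<close> and \<open>f\<close> the image of \<open>g e\<^sub>0\<close> under the adjoint on this subspace, the first component
\<open>u\<close> of \<open>\<Phi> f\<close> satisfies \<open>\<langle>u, g\<rangle> = \<parallel>f\<parallel>\<^sup>2\<close> and \<open>\<parallel>u\<parallel> \<le> \<parallel>f\<parallel>\<close>. So \<open>0 \<le> \<parallel>u - g\<parallel>\<^sup>2\<close> implies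
\<open>\<parallel>f\<parallel>\<^sup>2 \<le> \<parallel>g\<parallel>\<^sup>2\<close>, which is the claim.\<close>

theorem multiplier_row_pd_kernel_at:
  assumes nz: "k z z \<noteq> 0" and \<Phi>: "contractive_multiplier H ip N \<Phi>" and N: "0 < N"
  shows "pd UNIV (\<lambda>x y. kernel_at k z x y * (1 - (\<Sum>a<N. \<Phi> x $$ (0, a) * cnj (\<Phi> y $$ (0, a)))))"
proof (rule pdI)
  fix F :: "'a set" and c :: "'a \<Rightarrow> complex" assume F: "finite F"
  define K where "K y = (\<lambda>x. kernel_at k z x y)" for y
  define b where "b x a = \<Phi> x $$ (0, a)" for x a
  define f where "f a x = (\<Sum>y\<in>F. (c y * cnj (b y a)) * K y x)" for a x
  define g where "g x = (\<Sum>y\<in>F. c y * K y x)" for x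
  define u where "u x = (\<Sum>a<N. b x a * f a x)" for x
  define fv where "fv x = vec N (\<lambda>a. f a x)" for x
  define G where "G a x = (\<Phi> x *\<^sub>v fv x) $ a" for a x
  have KH: "K y \<in> H" for y unfolding K_def by (rule kernel_at_mem)
  have fH: "f a \<in> H" for a unfolding f_def[abs_def] by (rule lincomb_mem[OF KH])
  have gH: "g \<in> H" unfolding g_def[abs_def] by (rule lincomb_mem[OF KH])
  have fz: "f a z = 0" for a using kernel_at_vanishes[OF nz] by (simp add: f_def K_def)
  have gz: "g z = 0" using kernel_at_vanishes[OF nz] by (simp add: g_def K_def)
  have \<Phi>c: "\<Phi> x \<in> carrier_mat N N" for x using \<Phi> by (simp add: contractive_multiplier_def)
  have fv: "fv \<in> tensor_space H N"
    unfolding tensor_space_def fv_def using fH by (auto simp: eta_contract_eq)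
  have Gu: "G 0 = u"
    using carrier_matD[OF \<Phi>c] N
    by (simp add: G_def u_def b_def fv_def scalar_prod_def lessThan_atLeast0 fun_eq_iff)
  have GH: "G a \<in> H" if "a < N" for a
    using \<Phi> fv that by (auto simp: contractive_multiplier_def tensor_space_def G_def[abs_def])
  have uH: "u \<in> H" using GH[OF N] Gu by simp
  have uz: "u z = 0" by (simp add: u_def fz)
  define A where "A = (\<Sum>a<N. ip (f a) (f a))"
  have "tensor_norm ip N (\<lambda>x. \<Phi> x *\<^sub>v fv x) \<le> tensor_norm ip N fv"
    using \<Phi> fv by (simp add: contractive_multiplier_def)
  then have "(\<Sum>a<N. Re (ip (G a) (G a))) \<le> (\<Sum>a<N. Re (ip (\<lambda>x. fv x $ a) (\<lambda>x. fv x $ a)))"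
    by (simp add: tensor_norm_def G_def[abs_def])
  also have "\<dots> = Re A" by (simp add: A_def fv_def)
  finally have "(\<Sum>a<N. Re (ip (G a) (G a))) \<le> Re A" .
  moreover have "Re (ip (G 0) (G 0)) \<le> (\<Sum>a<N. Re (ip (G a) (G a)))"
    by (rule member_le_sum[of 0 "{..<N}" "\<lambda>a. Re (ip (G a) (G a))"])
      (use N ip_nonneg[OF GH] in \<open>auto simp: less_eq_complex_def\<close>)
  ultimately have uA: "Re (ip u u) \<le> Re A" by (simp add: Gu)
  have ipK: "ip h (K y) = h y" if "h \<in> H" "h z = 0" for h y
    unfolding K_def by (rule kernel_at_reproducing[OF that])
  have ug: "ip u g = (\<Sum>y\<in>F. cnj (c y) * u y)"
    unfolding g_def[abs_def] using ip_lincomb_right[of F K u c] KH uH ipK[OF uH uz] by simp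
  have "ip (f a) (f a) = (\<Sum>y\<in>F. cnj (c y) * (b y a * f a y))" for a
    using ip_lincomb_right[of F K "f a" "\<lambda>y. c y * cnj (b y a)"] KH fH ipK[OF fH fz]
    by (simp add: f_def[abs_def] mult.assoc)
  then have "A = (\<Sum>a<N. \<Sum>y\<in>F. cnj (c y) * (b y a * f a y))" by (simp add: A_def)
  also have "\<dots> = (\<Sum>y\<in>F. cnj (c y) * u y)"
    by (subst sum.swap) (simp add: u_def sum_distrib_left)
  finally have Au: "A = (\<Sum>y\<in>F. cnj (c y) * u y)" .
  have A_real: "A = of_real (Re A)" unfolding A_def using ip_real[OF fH] by (simp add: complex_eq_iff)
  have gg: "ip g g = (\<Sum>y\<in>F. cnj (c y) * g y)"
    using ip_lincomb_right[of F K g c] KH gH ipK[OF gH gz] by (simp add: g_def[abs_def])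
  have gu: "ip g u = A" using ip_sym[OF uH gH] ug Au A_real by (metis complex_cnj_complex_of_real)
  have "0 \<le> Re (ip (\<lambda>x. u x - g x) (\<lambda>x. u x - g x))"
    using ip_nonneg[OF diff_mem[OF uH gH]] by (simp add: less_eq_complex_def)
  also have "\<dots> = Re (ip u u) - Re A - Re A + Re (ip g g)"
    using uH gH by (simp add: ip_diff_left ip_diff_right diff_mem ug gu flip: Au)
  finally have "0 \<le> Re (ip g g) - Re A" using uA by simp
  then have "0 \<le> ip g g - A" using ip_real[OF gH] A_real by (simp add: less_eq_complex_def complex_eq_iff)
  also have "ip g g - A = (\<Sum>x\<in>F. cnj (c x) * (g x - u x))"
    unfolding gg Au by (simp add: right_diff_distrib sum_subtractf)
  also have "\<dots> = (\<Sum>x\<in>F. \<Sum>y\<in>F. cnj (c x) * (kernel_at k z x y * (1 - (\<Sum>a<N. \<Phi> x $$ (0, a) * cnj (\<Phi> y $$ (0, a))))) * c y)"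
  proof (rule sum.cong[OF refl])
    fix x
    have "u x = (\<Sum>y\<in>F. \<Sum>a<N. b x a * (c y * cnj (b y a) * K y x))"
      unfolding u_def f_def sum_distrib_left by (rule sum.swap)
    also have "\<dots> = (\<Sum>y\<in>F. K y x * (\<Sum>a<N. b x a * cnj (b y a)) * c y)"
      by (simp add: sum_distrib_left sum_distrib_right mult_ac)
    finally have "g x - u x = (\<Sum>y\<in>F. K y x * (1 - (\<Sum>a<N. b x a * cnj (b y a))) * c y)"
      by (simp add: g_def right_diff_distrib left_diff_distrib sum_subtractf mult.commute)
    then show "cnj (c x) * (g x - u x) = (\<Sum>y\<in>F. cnj (c x) * (kernel_at k z x y * (1 - (\<Sum>a<N. \<Phi> x $$ (0, a) * cnj (\<Phi> y $$ (0, a))))) * c y)"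
      by (simp add: sum_distrib_left mult.assoc K_def b_def)
  qed
  finally show "0 \<le> \<dots>" .
qed

end

text \<open>The induction uses the hypothesis for the base point \<open>w\<close> that is being added: it gives
positivity of \<open>s\<^sup>w / s\<close> on \<open>F\<close>, and on \<open>insert w F\<close> as well since the row at \<open>w\<close> vanishes. A factor
\<open>b\<close> of this matrix serves as interpolation data, and the interpolant gives positivity of \<open>s\<^sup>z / s\<close>
for every base point \<open>z\<close>.\<close>

lemma pd_quotient_by_complete_pick_finite:
  fixes s :: "'a \<Rightarrow> 'a \<Rightarrow> complex"
  assumes cp: "complete_pick_kernel s" and nz: "\<And>x y. s x y \<noteq> 0" and F: "finite F"
  shows "pd F (\<lambda>x y. kernel_at s z x y / s x y)"
  using F
proof (induction F arbitrary: z rule: finite_induct)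
  case empty
  show ?case by (rule pdI) auto
next
  case (insert w F)
  define Q where "Q z x y = kernel_at s z x y / s x y" for z x y
  have s: "pd UNIV s" using cp by (simp add: complete_pick_kernel_def is_kernel_iff_pd)
  obtain H ip where rk: "rkhs s H ip" and pick: "\<And>n N z W. n \<ge> 1 \<Longrightarrow> N \<ge> 1 \<Longrightarrow>
      \<forall>i<n. W i \<in> carrier_mat N N \<Longrightarrow> psd_on ({..<n} \<times> {..<N}) (pick_matrix s N z W) \<Longrightarrow>
      \<exists>\<Phi>. contractive_multiplier H ip N \<Phi> \<and> (\<forall>i<n. \<Phi> (z i) = W i)"
    using cp unfolding complete_pick_kernel_def by blast
  define E where "E = insert w F"
  have E: "finite E" using insert by (simp add: E_def)
  have "pd E (Q w)"
  proof -
    have "pd E (\<lambda>x y. if x \<in> F \<and> y \<in> F then Q w x y else 0)"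
    proof (rule pdI)
      fix G :: "'a set" and c :: "'a \<Rightarrow> complex" assume G: "finite G" "G \<subseteq> E"
      have "0 \<le> (\<Sum>x\<in>G \<inter> F. \<Sum>y\<in>G \<inter> F. cnj (c x) * Q w x y * c y)"
        by (rule pdD[OF insert.IH[of w, folded Q_def]]) (use G in auto)
      also have "\<dots> = (\<Sum>x\<in>G. \<Sum>y\<in>G. cnj (if x \<in> G \<inter> F then c x else 0) * Q w x y * (if y \<in> G \<inter> F then c y else 0))"
        by (rule form_extend[symmetric]) (use G in auto)
      also have "\<dots> = (\<Sum>x\<in>G. \<Sum>y\<in>G. cnj (c x) * (if x \<in> F \<and> y \<in> F then Q w x y else 0) * c y)"
        by (intro sum.cong refl) auto
      finally show "0 \<le> \<dots>" .
    qed
    then show ?thesis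
    proof (rule pd_cong)
      fix x y assume "x \<in> E" "y \<in> E"
      then show "Q w x y = (if x \<in> F \<and> y \<in> F then Q w x y else 0)"
        using nz[of w w] by (auto simp: E_def Q_def kernel_at_def)
    qed
  qed
  from pd_factor_finite[OF E this] obtain m :: nat and b where
    b: "\<And>x y. x \<in> E \<Longrightarrow> y \<in> E \<Longrightarrow> Q w x y = (\<Sum>i<m. b i x * cnj (b i y))" by metis
  have ss: "s x y * (1 - Q w x y) = s x w * s w y / s w w" for x y
    using nz[of x y] by (simp add: Q_def kernel_at_def field_simps)
  define r where "r = sqrt (Re (s w w))"
  have r: "s w w = of_real r * of_real r"
    using pd_diag_real[OF s, of w] by (simp add: r_def flip: of_real_mult)
  have r0: "r \<noteq> 0" using nz[of w w] r by auto
  define \<delta> where "\<delta> x = s x w / of_real r" for x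
  have \<delta>: "s x w * s w y / s w w = \<delta> x * cnj (\<delta> y)" for x y
    using pd_hermitian[OF s, of y w] r by (simp add: \<delta>_def)
  have \<delta>0: "\<delta> x \<noteq> 0" for x using nz r0 by (simp add: \<delta>_def)
  define N where "N = Suc m"
  \<comment> \<open>The row \<open>b x\<close>, filled up with zeros to a square matrix. The Pick matrix is block diagonal:
    the corner block is \<open>\<delta> \<delta>*\<close>, all other diagonal blocks are \<open>s\<close>.\<close>
  define W0 where "W0 x = mat N N (\<lambda>(i, j). if i = 0 \<and> j < m then b j x else 0)" for x
  have W0: "W0 x \<in> carrier_mat N N" for x by (simp add: W0_def)
  have row: "(\<Sum>c<N. W0 x $$ (0, c) * cnj (W0 y $$ (0, c))) = Q w x y" if "x \<in> E" "y \<in> E" for x y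
    by (simp add: W0_def N_def b[OF that])
  have row0: "W0 x $$ (a, c) = 0" if "a \<noteq> 0" "a < N" "c < N" for x a c
    using that by (simp add: W0_def)
  obtain zz where zz: "bij_betw zz {..<card E} E"
    using ex_bij_betw_nat_finite[OF E] by (auto simp: lessThan_atLeast0)
  have zzE: "zz i \<in> E" if "i < card E" for i using zz that by (auto simp: bij_betw_def)
  have "pd ({..<card E} \<times> {..<N}) (\<lambda>t u.
      (if snd t = 0 then \<delta> (zz (fst t)) else 0) * cnj (if snd u = 0 then \<delta> (zz (fst u)) else 0)
      + (of_bool (snd t \<noteq> 0) * cnj (of_bool (snd u \<noteq> 0))) * ((if snd t = snd u then 1 else 0) * s (zz (fst t)) (zz (fst u))))"
    by (intro pd_add pd_mult pd_rank_one pd_pullback[OF s] pd_pullback[OF pd_delta, of snd _ UNIV]) auto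
  then have "pd ({..<card E} \<times> {..<N}) (pick_matrix s N zz (\<lambda>i. W0 (zz i)))"
  proof (rule pd_cong)
    fix t u assume "t \<in> {..<card E} \<times> {..<N}" "u \<in> {..<card E} \<times> {..<N}"
    then obtain i a j b where tu: "t = (i, a)" "u = (j, b)" "i < card E" "a < N" "j < card E" "b < N" by auto
    have e: "pick_matrix s N zz (\<lambda>i. W0 (zz i)) t u = s (zz i) (zz j) *
       ((if a = b then 1 else 0) - (\<Sum>c<N. W0 (zz i) $$ (a, c) * cnj (W0 (zz j) $$ (b, c))))"
      unfolding tu(1,2) by (rule pick_matrix_entry) (use W0 tu in auto)
    show "pick_matrix s N zz (\<lambda>i. W0 (zz i)) t u =
      (if snd t = 0 then \<delta> (zz (fst t)) else 0) * cnj (if snd u = 0 then \<delta> (zz (fst u)) else 0)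
      + (of_bool (snd t \<noteq> 0) * cnj (of_bool (snd u \<noteq> 0))) * ((if snd t = snd u then 1 else 0) * s (zz (fst t)) (zz (fst u)))"
    proof (cases "a = 0 \<and> b = 0")
      case True
      then show ?thesis unfolding e using row[OF zzE zzE] tu ss \<delta> by simp
    next
      case False
      then have "(\<Sum>c<N. W0 (zz i) $$ (a, c) * cnj (W0 (zz j) $$ (b, c))) = 0"
        using row0 tu by (intro sum.neutral) auto
      then show ?thesis unfolding e using False tu by auto
    qed
  qed
  then have "psd_on ({..<card E} \<times> {..<N}) (pick_matrix s N zz (\<lambda>i. W0 (zz i)))"
    by (simp add: psd_on_iff_pd)
  moreover have "1 \<le> card E" using E by (simp add: E_def card_gt_0_iff Suc_le_eq)
  ultimately obtain \<Phi> where \<Phi>: "contractive_multiplier H ip N \<Phi>" and \<Phi>zz: "\<forall>i<card E. \<Phi> (zz i) = W0 (zz i)"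
    using pick[of "card E" N "\<lambda>i. W0 (zz i)" zz] W0 by (auto simp: N_def)
  have \<Phi>E: "\<Phi> x = W0 x" if x: "x \<in> E" for x
  proof -
    obtain i where "i < card E" "x = zz i" using bij_betw_imp_surj_on[OF zz] x by auto
    then show ?thesis using \<Phi>zz by simp
  qed
  have "pd E (\<lambda>x y. kernel_at s z x y * (1 - (\<Sum>a<N. \<Phi> x $$ (0, a) * cnj (\<Phi> y $$ (0, a)))))"
    by (rule pd_subset[OF rkhs.multiplier_row_pd_kernel_at[OF rk nz \<Phi>]]) (auto simp: N_def)
  from pd_congruence[OF this, of "\<lambda>x. 1 / \<delta> x"]
  have "pd E (Q z)"
  proof (rule pd_cong)
    fix x y assume xy: "x \<in> E" "y \<in> E"
    have "(1 - Q w x y) = \<delta> x * cnj (\<delta> y) / s x y"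
      using ss[of x y] nz[of x y] unfolding \<delta> by (simp add: field_simps)
    then have "kernel_at s z x y * (1 - (\<Sum>a<N. \<Phi> x $$ (0, a) * cnj (\<Phi> y $$ (0, a))))
       = Q z x y * (\<delta> x * cnj (\<delta> y))"
      unfolding \<Phi>E[OF xy(1)] \<Phi>E[OF xy(2)] row[OF xy] by (simp add: Q_def[of z])
    then show "Q z x y = 1 / \<delta> x * (kernel_at s z x y * (1 - (\<Sum>a<N. \<Phi> x $$ (0, a) * cnj (\<Phi> y $$ (0, a))))) * cnj (1 / \<delta> y)"
      using \<delta>0[of x] \<delta>0[of y] by simp
  qed
  then show ?case by (simp add: E_def Q_def[abs_def])
qed

theorem pd_quotient_by_complete_pick:
  fixes s :: "'a \<Rightarrow> 'a \<Rightarrow> complex"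
  assumes cp: "complete_pick_kernel s" and nz: "\<And>x y. s x y \<noteq> 0"
  shows "pd UNIV (\<lambda>x y. kernel_at s z x y / s x y)"
  unfolding pd_def
proof (intro allI impI)
  fix F :: "'a set" assume "finite F"
  then show "psd_on F (\<lambda>x y. kernel_at s z x y / s x y)"
    using pd_quotient_by_complete_pick_finite[OF cp nz] by (simp add: psd_on_iff_pd)
qed

section \<open>Shimorin certificates\<close>

text \<open>The candidate for the complete Pick kernel is forced, up to the choice of \<open>\<kappa>\<close>, by the requirement that
\<open>s\<^sup>z = p s\<close>: then \<open>(1 - p) s\<close> has rank one, and its generator is taken from the column of \<open>k\<close> at \<open>z\<close>.\<close>

theorem strong_certificate_of_point:
  fixes k l p :: "'a \<Rightarrow> 'a \<Rightarrow> complex"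
  assumes k: "pd UNIV k" and l: "pd UNIV l" and p: "pd UNIV p"
    and k0: "\<And>x. k x x \<noteq> 0" and l0: "\<And>x. l x z \<noteq> 0"
    and lp: "pd UNIV (\<lambda>x y. kernel_at l z x y - p x y * l x y)"
    and kp: "pd UNIV (\<lambda>x y. p x y * k x y - kernel_at k z x y)"
  shows "\<exists>s. strong_shimorin_certificate k l s"
proof -
  have lx: "Re (l x x) > 0" for x
  proof -
    have "l x x \<noteq> 0" using pd_zero_diag[OF l, of z x] pd_hermitian[OF l, of x z] l0[of x] by auto
    then show ?thesis using pd_diag_real[OF l, of x] by (metis UNIV_I less_eq_real_def of_real_0)
  qed
  have kx: "Re (k x x) > 0" for x
    using k0[of x] pd_diag_real[OF k, of x] by (metis UNIV_I less_eq_real_def of_real_0)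
  have lt: "Re (p x x) < 1" for x
  proof -
    have "0 \<le> Re (kernel_at l z x x - p x x * l x x)"
      using pd_diag_nonneg[OF lp, of x] by (simp add: less_eq_complex_def)
    moreover have "l x z * l z x / l z z = of_real ((norm (l x z))\<^sup>2 / Re (l z z))"
      using pd_hermitian[OF l, of x z] pd_diag_real(1)[OF l, of z]
      by (simp add: complex_norm_square del: of_real_power)
    moreover have "p x x * l x x = of_real (Re (p x x) * Re (l x x))"
      using pd_diag_real(1)[OF l, of x] pd_diag_real(1)[OF p, of x] by (metis UNIV_I of_real_mult)
    ultimately have "(norm (l x z))\<^sup>2 / Re (l z z) \<le> (1 - Re (p x x)) * Re (l x x)"
      by (simp add: kernel_at_def left_diff_distrib)
    moreover have "0 < (norm (l x z))\<^sup>2 / Re (l z z)" using l0[of x] lx[of z] by simp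
    ultimately have "0 < (1 - Re (p x x)) * Re (l x x)" by linarith
    then show ?thesis using lx[of x] by (simp add: zero_less_mult_iff)
  qed
  have p1: "1 - p x y \<noteq> 0" for x y using pd_norm_less_1[OF p, of x y] lt by auto
  have kz: "k x z \<noteq> 0" for x
  proof
    assume 0: "k x z = 0"
    have "0 \<le> p x x * k x x - k x x"
      using pd_diag_nonneg[OF kp, of x] 0 by (simp add: kernel_at_def)
    moreover have "p x x * k x x = of_real (Re (p x x) * Re (k x x))"
      using pd_diag_real(1)[OF k, of x] pd_diag_real(1)[OF p, of x] by (metis UNIV_I of_real_mult)
    ultimately have "0 \<le> (Re (p x x) - 1) * Re (k x x)"
      by (simp add: less_eq_complex_def left_diff_distrib)
    then show False using lt[of x] kx[of x] by (simp add: zero_le_mult_iff)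
  qed
  define r where "r = sqrt (Re (k z z))"
  have r: "k z z = of_real r * of_real r"
    using pd_diag_real[OF k, of z] by (simp add: r_def flip: of_real_mult)
  define \<kappa> where "\<kappa> x = k x z / of_real r" for x
  have \<kappa>0: "\<kappa> x \<noteq> 0" for x using kz r k0[of z] by (auto simp: \<kappa>_def)
  have \<kappa>: "k x z * k z y / k z z = \<kappa> x * cnj (\<kappa> y)" for x y
    using pd_hermitian[OF k, of y z] r by (simp add: \<kappa>_def)
  define s where "s x y = \<kappa> x * cnj (\<kappa> y) / (1 - p x y)" for x y
  define h where "h x y = (1 / \<kappa> x) * (p x y * k x y - kernel_at k z x y) * cnj (1 / \<kappa> y)" for x y
  define g where "g x y = (1 / \<kappa> x) * ((kernel_at l z x y - p x y * l x y) + l x z * l z y / l z z) * cnj (1 / \<kappa> y)" for x y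
  have "complete_pick_kernel s"
    unfolding s_def[abs_def] by (rule complete_pick_of_normalized_form[OF p lt \<kappa>0])
  moreover have "is_kernel h"
    unfolding is_kernel_iff_pd h_def[abs_def] by (intro pd_congruence kp)
  moreover have "is_kernel g"
    unfolding is_kernel_iff_pd g_def[abs_def] by (intro pd_congruence pd_add lp pd_column l)
  moreover have "k x y = (1 - h x y) * s x y" for x y
  proof -
    have "h x y = (p x y * k x y - (k x y - \<kappa> x * cnj (\<kappa> y))) / (\<kappa> x * cnj (\<kappa> y))"
      unfolding h_def kernel_at_def \<kappa> by simp
    moreover have "1 - b = (1 - q) * a / c" if "b = (q * a - (a - c)) / c" "c \<noteq> 0" for a b c q :: complex
      using that by (simp add: field_simps)
    moreover have "\<kappa> x * cnj (\<kappa> y) \<noteq> 0" using \<kappa>0[of x] \<kappa>0[of y] by simp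
    ultimately have "1 - h x y = (1 - p x y) * k x y / (\<kappa> x * cnj (\<kappa> y))"
      by blast
    then show ?thesis using \<kappa>0[of x] \<kappa>0[of y] p1[of x y] by (simp add: s_def)
  qed
  moreover have "l x y = s x y * g x y" for x y
  proof -
    have "(kernel_at l z x y - p x y * l x y) + l x z * l z y / l z z = (1 - p x y) * l x y"
      by (simp add: kernel_at_def left_diff_distrib)
    then have "g x y = (1 - p x y) * l x y / (\<kappa> x * cnj (\<kappa> y))"
      by (simp add: g_def)
    then show ?thesis using \<kappa>0[of x] \<kappa>0[of y] p1[of x y] by (simp add: s_def)
  qed
  ultimately show ?thesis unfolding strong_shimorin_certificate_def by blast
qed

text \<open>With \<open>t = h z z > 0\<close> the kernel equals \<open>h\<^sup>z + (h\<^sub>z - t) (h\<^sub>z - t)* / (t (1 - t))\<close>; for \<open>t = 0\<close> the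
column \<open>h\<^sub>z\<close> vanishes and it reduces to \<open>h\<close>.\<close>

lemma pd_moebius_defect:
  fixes h :: "'a \<Rightarrow> 'a \<Rightarrow> complex"
  assumes h: "pd UNIV h" and lt: "Re (h z z) < 1"
  shows "pd UNIV (\<lambda>x y. (1 - h x z) * (1 - h z y) / (1 - h z z) - (1 - h x y))"
proof -
  define t where "t = Re (h z z)"
  have t: "h z z = of_real t" "0 \<le> t" "t < 1" using pd_diag_real[OF h, of z] lt by (auto simp: t_def)
  show ?thesis
  proof (cases "t = 0")
    case True
    have "h x z = 0" "h z x = 0" for x
      using pd_zero_diag[OF h, of x z] pd_hermitian[OF h, of x z] t True by auto
    then show ?thesis using h t True by simp
  next
    case False
    define a where "a = 1 / sqrt (t * (1 - t))"
    have a: "complex_of_real a * of_real a = 1 / of_real (t * (1 - t))"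
      using t False by (simp add: a_def flip: of_real_mult)
    have "pd UNIV (\<lambda>x y. kernel_at h z x y + (of_real a * (h x z - of_real t)) * cnj (of_real a * (h y z - of_real t)))"
      by (intro pd_add pd_kernel_at h pd_rank_one)
    then show ?thesis
    proof (rule pd_cong)
      fix x y
      define u where "u = h x z"
      define w where "w = h z y"
      define T where "T = complex_of_real t"
      have T: "T \<noteq> 0" "1 - T \<noteq> 0" using False t(3) by (auto simp: T_def complex_eq_iff)
      have "cnj (h y z) = w" using pd_hermitian[OF h, of y z] by (simp add: w_def)
      then have "(of_real a * (h x z - of_real t)) * cnj (of_real a * (h y z - of_real t))
         = (complex_of_real a * of_real a) * ((u - T) * (w - T))" by (simp add: u_def T_def)
      also have "\<dots> = (u - T) * (w - T) / (T * (1 - T))" unfolding a by (simp add: T_def)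
      finally have e: "(of_real a * (h x z - of_real t)) * cnj (of_real a * (h y z - of_real t)) = (u - T) * (w - T) / (T * (1 - T))" .
      have i: "(1 - u) * (1 - w) / (1 - T) - 1 = - (u * w / T) + (u - T) * (w - T) / (T * (1 - T))"
        using T by (simp add: divide_simps) (simp add: algebra_simps)
      show "(1 - h x z) * (1 - h z y) / (1 - h z z) - (1 - h x y)
        = kernel_at h z x y + (of_real a * (h x z - of_real t)) * cnj (of_real a * (h y z - of_real t))"
        unfolding e kernel_at_def t(1) using i by (simp add: u_def w_def T_def algebra_simps)
    qed
  qed
qed

text \<open>Both differences are products of the rank-one kernel \<open>s\<^sub>z s\<^sub>z* / s(z,z)\<close> with a positive definite
function.\<close>

theorem certificate_of_strong_certificate:
  fixes k l s :: "'a \<Rightarrow> 'a \<Rightarrow> complex"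
  assumes k: "pd UNIV k" and k0: "\<And>x. k x x \<noteq> 0" and l0: "\<And>x y. l x y \<noteq> 0"
    and cert: "strong_shimorin_certificate k l s"
  shows "shimorin_certificate k l (\<lambda>z x y. kernel_at s z x y / s x y)"
proof -
  obtain h g where cp: "complete_pick_kernel s" and h: "pd UNIV h" and g: "pd UNIV g"
    and kh: "\<And>x y. k x y = (1 - h x y) * s x y" and lg: "\<And>x y. l x y = s x y * g x y"
    using cert by (auto simp: strong_shimorin_certificate_def is_kernel_iff_pd)
  have s: "pd UNIV s" using cp by (simp add: complete_pick_kernel_def is_kernel_iff_pd)
  have s0: "s x y \<noteq> 0" and g0: "g x y \<noteq> 0" for x y using l0[of x y] lg[of x y] by auto
  have "pd UNIV (\<lambda>x y. kernel_at s z x y / s x y)" for z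
    by (rule pd_quotient_by_complete_pick[OF cp s0])
  moreover have "pd UNIV (\<lambda>x y. kernel_at l z x y - kernel_at s z x y / s x y * l x y)" for z
  proof (rule pd_cong[OF pd_mult[OF pd_column[OF s, of z] pd_kernel_at[OF g, of z]]])
    fix x y
    show "kernel_at l z x y - kernel_at s z x y / s x y * l x y
       = s x z * s z y / s z z * kernel_at g z x y"
      using s0[of x y] s0[of z z] g0[of z z] unfolding kernel_at_def lg
      by (simp add: divide_simps) (simp add: algebra_simps)
  qed
  moreover have "pd UNIV (\<lambda>x y. kernel_at s z x y / s x y * k x y - kernel_at k z x y)" for z
  proof -
    have "Re (h z z) < 1"
    proof -
      have hz: "h z z = of_real (Re (h z z))" and sz: "s z z = of_real (Re (s z z))" "0 \<le> Re (s z z)"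
        using pd_diag_real[OF h, of z] pd_diag_real[OF s, of z] by auto
      have "k z z = of_real ((1 - Re (h z z)) * Re (s z z))"
        unfolding kh by (subst hz, subst sz(1)) simp
      then have "0 \<le> (1 - Re (h z z)) * Re (s z z)" "(1 - Re (h z z)) * Re (s z z) \<noteq> 0"
        using pd_diag_nonneg[OF k, of z] k0[of z] by (auto simp: less_eq_complex_def)
      then show ?thesis using sz(2) by (auto simp: zero_le_mult_iff)
    qed
    from pd_mult[OF pd_column[OF s, of z] pd_moebius_defect[OF h this]] show ?thesis
    proof (rule pd_cong)
      fix x y
      have h1: "1 - h z z \<noteq> 0" using k0[of z] kh[of z z] by auto
      show "kernel_at s z x y / s x y * k x y - kernel_at k z x y
        = s x z * s z y / s z z * ((1 - h x z) * (1 - h z y) / (1 - h z z) - (1 - h x y))"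
        using s0[of x y] s0[of z z] h1 unfolding kernel_at_def kh
        by (simp add: divide_simps) (simp add: algebra_simps)
    qed
  qed
  ultimately show ?thesis
    by (simp add: shimorin_certificate_def kernel_le_def is_kernel_iff_pd)
qed

theorem proposition3p6:
  fixes k l :: "'a \<Rightarrow> 'a \<Rightarrow> complex"
  assumes "is_kernel k" and "is_kernel l"
    and "\<And>x. k x x \<noteq> 0" and "\<And>x. l x x \<noteq> 0"
    and "\<And>z w. l z w \<noteq> 0"
  shows "((\<exists>p. shimorin_certificate k l p) \<longleftrightarrow> (\<exists>s. strong_shimorin_certificate k l s)) \<and>
    ((\<exists>s. strong_shimorin_certificate k l s) \<longleftrightarrow>
       (\<exists>p z0. is_kernel p \<and>
          kernel_le (\<lambda>w v. p w v * l w v) (kernel_at l z0) \<and>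
          kernel_le (kernel_at k z0) (\<lambda>w v. p w v * k w v)))"
proof -
  let ?certificate = "\<exists>p. shimorin_certificate k l p"
  let ?strong = "\<exists>s. strong_shimorin_certificate k l s"
  let ?point = "\<exists>p z0. is_kernel p \<and>
    kernel_le (\<lambda>w v. p w v * l w v) (kernel_at l z0) \<and>
    kernel_le (kernel_at k z0) (\<lambda>w v. p w v * k w v)"
  have "?strong \<Longrightarrow> ?certificate"
  proof -
    assume ?strong
    then obtain s where s: "strong_shimorin_certificate k l s" ..
    show ?certificate
      by (rule exI, rule certificate_of_strong_certificate[OF _ assms(3) assms(5) s])
        (use assms(1) in \<open>simp add: is_kernel_iff_pd\<close>)
  qed
  moreover have "?certificate \<Longrightarrow> ?point"
    unfolding shimorin_certificate_def by blast
  moreover have "?point \<Longrightarrow> ?strong"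
    using strong_certificate_of_point[of k l] assms by (auto simp: kernel_le_def is_kernel_iff_pd)
  ultimately show ?thesis by blast
qed

end
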